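(* The number of simple order types with at most $2$ interior points of size $n+2$ is $\Theta\!\left(\frac{4^n}{n^{3/2}}\right)$ as $n\to\infty$.
   Context: The orientation of an ordered triple of points in the plane is positive if they appear in counterclockwise order around their convex hull, negative if clockwise, and zero if they are collinear. Two finite point sets (configurations) $P,Q\subset\mathbb{R}^2$ have the same order type if there is a bijection between them preserving the orientation of every ordered triple. An order type is an equivalence class of this relation (so points are unlabelled); its size is the number of points of any of its members. An order type is simple if it has no collinear triples. The extreme points of a configuration are the vertices of its convex hull, and its other points are its interior points. *)

theory Defs
  imports "HOL-Analysis.Analysis" "HOL-Library.Landau_Symbols"
begin

text \<open>
  The determinant is twice the signed area of the triangle \<open>abc\<close>: it is positive iff \<open>a, b, c\<close>
  appear in counterclockwise order around their convex hull, negative iff they appear in clockwise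
  order, and zero iff they are collinear (in particular if two of them coincide).
\<close>

definition orientation :: "real^2 \<Rightarrow> real^2 \<Rightarrow> real^2 \<Rightarrow> real" where
  "orientation a b c = sgn (det (vector [b - a, c - a] :: real^2^2))"

lemma orientation_eq:
  "orientation a b c =
     sgn ((b $ 1 - a $ 1) * (c $ 2 - a $ 2) - (b $ 2 - a $ 2) * (c $ 1 - a $ 1))"
  by (simp add: orientation_def det_2)

lemma orientation_eq_0_iff_collinear: "orientation a b c = 0 \<longleftrightarrow> collinear {a, b, c}"
proof -
  define x where "x = b - a"
  define y where "y = c - a"
  have "collinear {a, b, c} \<longleftrightarrow> collinear {b, a, c}"
    by (simp add: insert_commute)
  also have "\<dots> \<longleftrightarrow> collinear {0, x, y}"
    unfolding x_def y_def by (rule collinear_3[unfolded NO_MATCH_def]) simp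
  also have "\<dots> \<longleftrightarrow> x $ 1 * y $ 2 - x $ 2 * y $ 1 = 0"
  proof
    assume "collinear {0, x, y}"
    then show "x $ 1 * y $ 2 - x $ 2 * y $ 1 = 0"
      by (auto simp: collinear_lemma)
  next
    assume eq: "x $ 1 * y $ 2 - x $ 2 * y $ 1 = 0"
    show "collinear {0, x, y}"
    proof (cases "x = 0")
      case False
      then consider "x $ 1 \<noteq> 0" | "x $ 2 \<noteq> 0"
        by (auto simp: vec_eq_iff forall_2)
      then have "\<exists>k. y = k *\<^sub>R x"
      proof cases
        case 1
        with eq have "y = (y $ 1 / x $ 1) *\<^sub>R x"
          by (auto simp: vec_eq_iff forall_2 field_simps)
        then show ?thesis ..
      next
        case 2
        with eq have "y = (y $ 2 / x $ 2) *\<^sub>R x"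
          by (auto simp: vec_eq_iff forall_2 field_simps)
        then show ?thesis ..
      qed
      then show ?thesis by (auto simp: collinear_lemma)
    qed (simp add: collinear_lemma)
  qed
  also have "\<dots> \<longleftrightarrow> orientation a b c = 0"
    by (simp add: orientation_eq x_def y_def sgn_0_0)
  finally show ?thesis by simp
qed

definition same_order_type :: "(real^2) set \<Rightarrow> (real^2) set \<Rightarrow> bool" where
  "same_order_type P Q \<longleftrightarrow>
     (\<exists>f. bij_betw f P Q \<and>
          (\<forall>a\<in>P. \<forall>b\<in>P. \<forall>c\<in>P. orientation (f a) (f b) (f c) = orientation a b c))"

definition order_type_rel :: "((real^2) set \<times> (real^2) set) set" where
  "order_type_rel = {(P, Q). finite P \<and> finite Q \<and> same_order_type P Q}"

lemma equiv_order_type_rel: "equiv {P. finite P} order_type_rel"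
proof (rule equivI)
  show "order_type_rel \<subseteq> {P. finite P} \<times> {P. finite P}"
    by (auto simp: order_type_rel_def)
  show "refl_on {P. finite P} order_type_rel"
    by (auto simp: refl_on_def order_type_rel_def same_order_type_def intro!: exI[of _ id])
  show "sym order_type_rel"
  proof (rule symI)
    fix P Q assume "(P, Q) \<in> order_type_rel"
    then obtain f where fin: "finite P" "finite Q" and f: "bij_betw f P Q"
      and o: "\<forall>a\<in>P. \<forall>b\<in>P. \<forall>c\<in>P. orientation (f a) (f b) (f c) = orientation a b c"
      by (auto simp: order_type_rel_def same_order_type_def)
    let ?g = "inv_into P f"
    have g: "bij_betw ?g Q P" using f by (rule bij_betw_inv_into)
    moreover have "orientation (?g a) (?g b) (?g c) = orientation a b c"
      if "a \<in> Q" "b \<in> Q" "c \<in> Q" for a b c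
    proof -
      have "?g a \<in> P" "?g b \<in> P" "?g c \<in> P" using that bij_betwE[OF g] by auto
      with o have "orientation (f (?g a)) (f (?g b)) (f (?g c)) = orientation (?g a) (?g b) (?g c)"
        by blast
      with that show ?thesis by (simp add: bij_betw_inv_into_right[OF f])
    qed
    ultimately show "(Q, P) \<in> order_type_rel"
      using fin by (auto simp: order_type_rel_def same_order_type_def)
  qed
  show "trans order_type_rel"
  proof (rule transI)
    fix P Q R assume "(P, Q) \<in> order_type_rel" "(Q, R) \<in> order_type_rel"
    then obtain f g where fin: "finite P" "finite R"
      and f: "bij_betw f P Q" and g: "bij_betw g Q R"
      and fo: "\<forall>a\<in>P. \<forall>b\<in>P. \<forall>c\<in>P. orientation (f a) (f b) (f c) = orientation a b c"
      and go: "\<forall>a\<in>Q. \<forall>b\<in>Q. \<forall>c\<in>Q. orientation (g a) (g b) (g c) = orientation a b c"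
      by (auto simp: order_type_rel_def same_order_type_def)
    have "bij_betw (g \<circ> f) P R" using f g by (rule bij_betw_trans)
    moreover have "\<forall>a\<in>P. \<forall>b\<in>P. \<forall>c\<in>P.
        orientation ((g \<circ> f) a) ((g \<circ> f) b) ((g \<circ> f) c) = orientation a b c"
      using fo go bij_betwE[OF f] by simp
    ultimately show "(P, R) \<in> order_type_rel"
      using fin unfolding order_type_rel_def same_order_type_def by blast
  qed
qed

definition order_types :: "(real^2) set set set" where
  "order_types = {P. finite P} // order_type_rel"

definition simple_config :: "(real^2) set \<Rightarrow> bool" where
  "simple_config P \<longleftrightarrow>
     (\<forall>a\<in>P. \<forall>b\<in>P. \<forall>c\<in>P. a \<noteq> b \<and> b \<noteq> c \<and> a \<noteq> c \<longrightarrow> \<not> collinear {a, b, c})"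

definition extreme_points :: "(real^2) set \<Rightarrow> (real^2) set" where
  "extreme_points P = {x. x extreme_point_of (convex hull P)}"

text \<open>
  The points of \<open>P\<close> that are not vertices of its convex hull; for a non-simple \<open>P\<close> this need not
  be the part of \<open>P\<close> in the topological interior of the hull.
\<close>

definition interior_points :: "(real^2) set \<Rightarrow> (real^2) set" where
  "interior_points P = P - extreme_points P"

text \<open>
  Size, simplicity and the number of interior points are the same for all members of an order
  type, and the members of \<open>order_types\<close> are nonempty, so the quantifier over the members below
  could equivalently be existential.
\<close>

definition simple_order_types :: "nat \<Rightarrow> nat \<Rightarrow> (real^2) set set set" where
  "simple_order_types m k =
     {T \<in> order_types. \<forall>P\<in>T. simple_config P \<and> card P = m \<and> card (interior_points P) \<le> k}"

end

theory Submission
  imports Defs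
begin

text \<open>
  Choose two points \<open>p\<close>, \<open>q\<close> of the configuration such that the other \<open>n\<close> points are all extreme.
  Sort these \<open>n\<close> points by the slope of their line through \<open>p\<close>, and also by the slope of their line
  through \<open>q\<close>, and record each time the positions of the points to the left of \<open>pq\<close>. The two position
  sets determine the order type. Passing from \<open>p\<close> to \<open>q\<close> moves the left points to later positions, so
  the two sets form a pair of non-crossing lattice paths with common endpoints; there are
  Catalan-many (\<open>C\<^bsub>n+1\<^esub>\<close>) such pairs, which gives the upper bound.

  Conversely every such pair occurs for points on a parabola: take \<open>p\<close>, \<open>q\<close> on its axis, and
  parametrise the left half by \<open>-exp (-y)\<close> and the right half by \<open>exp z\<close>. The slope orders about
  \<open>p\<close> and \<open>q\<close> then compare the numbers \<open>z\<close> with \<open>y\<close> and with \<open>y + 1\<close>, and what is needed is that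
  a family of intervals without nesting can be replaced by unit intervals. If both position sets
  end in the pattern left-right-left, then \<open>p\<close> and \<open>q\<close> are exactly the interior points, so such an
  order type arises from at most two pairs. This gives the lower bound.
\<close>

section \<open>Orientations and marked configurations\<close>

text \<open>The orientation before taking signs, twice the signed area of the triangle, so that
  polynomial identities and inequalities are available.\<close>

definition turn :: "real^2 \<Rightarrow> real^2 \<Rightarrow> real^2 \<Rightarrow> real" where
  "turn a b c = (b $ 1 - a $ 1) * (c $ 2 - a $ 2) - (b $ 2 - a $ 2) * (c $ 1 - a $ 1)"

lemma orientation_turn: "orientation a b c = sgn (turn a b c)"
  by (simp add: orientation_eq turn_def)

lemma turn_same [simp]: "turn a a b = 0" "turn a b a = 0" "turn a b b = 0"
  by (simp_all add: turn_def)

lemma turn_rotate: "turn b c a = turn a b c"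
  by (simp add: turn_def algebra_simps)

lemma turn_swap: "turn a c b = - turn a b c"
  by (simp add: turn_def algebra_simps)

lemma turn_swap': "turn b a c = - turn a b c"
  by (simp add: turn_def algebra_simps)

text \<open>The three-term Grassmann-Pluecker relation for the vectors from \<open>p\<close>; the
  transitivity of \<open>before\<close> rests on it.\<close>

lemma turn_plucker: "turn p a b * turn p c d - turn p a c * turn p b d + turn p a d * turn p b c = 0"
  by (simp add: turn_def algebra_simps)

lemma turn_nonzero:
  assumes "simple_config P" "a \<in> P" "b \<in> P" "c \<in> P" "a \<noteq> b" "b \<noteq> c" "a \<noteq> c"
  shows "turn a b c \<noteq> 0"
  using assms orientation_eq_0_iff_collinear[of a b c]
  by (auto simp: simple_config_def orientation_turn sgn_0_0)

text \<open>The point \<open>x\<close> is in the open triangle \<open>a b c\<close>, whose corners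
  are listed counterclockwise. Only signs of turns occur, so orientation-preserving bijections
  respect it.\<close>

definition enclosed :: "real^2 \<Rightarrow> real^2 \<Rightarrow> real^2 \<Rightarrow> real^2 \<Rightarrow> bool" where
  "enclosed x a b c \<longleftrightarrow> turn x a b > 0 \<and> turn x b c > 0 \<and> turn x c a > 0"

text \<open>The three turns are the barycentric coordinates of \<open>x\<close>, up to the factor
  \<open>T\<close>.\<close>

lemma enclosed_in_hull:
  assumes "enclosed x a b c"
  shows "x \<in> convex hull {a, b, c}"
proof -
  define T where "T = turn x b c + turn x c a + turn x a b"
  have T: "T > 0" using assms by (simp add: T_def enclosed_def)
  have "T *\<^sub>R x = turn x b c *\<^sub>R a + turn x c a *\<^sub>R b + turn x a b *\<^sub>R c"
    by (simp add: vec_eq_iff forall_2 T_def turn_def algebra_simps)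
  then have "(1 / T) *\<^sub>R (T *\<^sub>R x) =
      (1 / T) *\<^sub>R (turn x b c *\<^sub>R a + turn x c a *\<^sub>R b + turn x a b *\<^sub>R c)"
    by simp
  then have "x = (turn x b c / T) *\<^sub>R a + (turn x c a / T) *\<^sub>R b + (turn x a b / T) *\<^sub>R c"
    using T by (simp add: scaleR_add_right)
  moreover have "turn x b c / T + turn x c a / T + turn x a b / T = 1"
    using T by (simp add: T_def add_divide_distrib[symmetric])
  moreover have "0 \<le> turn x b c / T" "0 \<le> turn x c a / T" "0 \<le> turn x a b / T"
    using T assms by (auto simp: enclosed_def)
  ultimately show ?thesis unfolding convex_hull_3 by blast
qed

text \<open>The turns at \<open>x\<close> are the barycentric coordinates times \<open>T\<close>,
  and simplicity keeps them from vanishing; the sign of \<open>T\<close> selects the alternative.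
  The corners are not assumed distinct, so hulls of one or two points are covered as well.\<close>

lemma hull_3_enclosed:
  assumes "x \<in> convex hull {a, b, c}" "simple_config P"
    and "x \<in> P" "a \<in> P" "b \<in> P" "c \<in> P" "x \<notin> {a, b, c}"
  shows "enclosed x a b c \<or> enclosed x a c b"
proof -
  from assms(1) obtain u v w where uvw: "u \<ge> 0" "v \<ge> 0" "w \<ge> 0" "u + v + w = 1"
    and x: "x = u *\<^sub>R a + v *\<^sub>R b + w *\<^sub>R c"
    unfolding convex_hull_3 by blast
  define T where "T = turn a b c"
  have u: "u = 1 - v - w" using uvw by simp
  have xc: "x $ 1 = u * a $ 1 + v * b $ 1 + w * c $ 1" "x $ 2 = u * a $ 2 + v * b $ 2 + w * c $ 2"
    by (simp_all add: x)
  have t: "turn x a b = w * T" "turn x b c = u * T" "turn x c a = v * T"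
    unfolding turn_def T_def xc u by (simp_all add: algebra_simps)
  have nz: "turn x a b \<noteq> 0" if "a \<noteq> b" using turn_nonzero[OF assms(2), of x a b] assms that by auto
  have nz2: "turn x b c \<noteq> 0" if "b \<noteq> c" using turn_nonzero[OF assms(2), of x b c] assms that by auto
  have nz3: "turn x c a \<noteq> 0" if "c \<noteq> a" using turn_nonzero[OF assms(2), of x c a] assms that by auto
  have "a \<noteq> b \<or> b \<noteq> c"
  proof (rule ccontr)
    assume "\<not> ?thesis"
    then have "x = (u + v + w) *\<^sub>R a" by (simp add: x scaleR_add_left)
    then show False using uvw(4) assms(7) by simp
  qed
  then have "T \<noteq> 0" using nz nz2 t by auto
  then have d: "a \<noteq> b" "b \<noteq> c" "c \<noteq> a" by (auto simp: T_def)
  have pos: "u > 0" "v > 0" "w > 0"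
    using nz[OF d(1)] nz2[OF d(2)] nz3[OF d(3)] t uvw by (auto simp: less_le)
  show ?thesis
  proof (cases "T > 0")
    case True
    then show ?thesis using pos t by (simp add: enclosed_def)
  next
    case False
    then have "- T > 0" using \<open>T \<noteq> 0\<close> by simp
    then have "w * (- T) > 0" "u * (- T) > 0" "v * (- T) > 0" using pos by (simp_all only: mult_pos_pos)
    then show ?thesis using t by (simp add: enclosed_def turn_swap[of x c b] turn_swap[of x b a] turn_swap[of x a c])
  qed
qed

text \<open>By Caratheodory a non-extreme point lies in the hull of at most three other points.
  Conversely, deleting an extreme point leaves the hull convex, so no triangle on the other points
  can contain it. Being interior thereby becomes a condition on orientations.\<close>

lemma interior_points_iff:
  assumes "finite P" "simple_config P"
  shows "x \<in> interior_points P \<longleftrightarrow> x \<in> P \<and> (\<exists>a\<in>P. \<exists>b\<in>P. \<exists>c\<in>P. enclosed x a b c)"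
proof safe
  assume "x \<in> interior_points P"
  then have x: "x \<in> P" "\<not> x extreme_point_of (convex hull P)"
    by (auto simp: interior_points_def extreme_points_def)
  show "x \<in> P" by fact
  have "insert x (P - {x}) = P" using x(1) by auto
  then have "x \<in> convex hull (P - {x})"
    using extreme_point_of_convex_hull_insert[of "P - {x}" x] assms(1) x(2) by auto
  then obtain S where S: "finite S" "S \<subseteq> P - {x}" "card S \<le> 3" "x \<in> convex hull S"
    using caratheodory[of "P - {x}"] by (auto simp: eval_nat_numeral)
  have "S \<noteq> {}" using S(4) by auto
  have "\<exists>a b c. S = {a, b, c}"
  proof -
    have "card S = 1 \<or> card S = 2 \<or> card S = 3"
      using S(1,3) \<open>S \<noteq> {}\<close> card_gt_0_iff[of S] by linarith
    then show ?thesis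
      using card_1_singletonE[of S] card_2_iff[of S] card_3_iff[of S] by (metis insert_absorb2)
  qed
  then obtain a b c where abc: "S = {a, b, c}" by blast
  then have "enclosed x a b c \<or> enclosed x a c b"
    using hull_3_enclosed[of x a b c P] assms(2) S x(1) by auto
  then show "\<exists>a\<in>P. \<exists>b\<in>P. \<exists>c\<in>P. enclosed x a b c" using S(2) abc by blast
next
  fix a b c assume x: "x \<in> P" and abc: "a \<in> P" "b \<in> P" "c \<in> P" "enclosed x a b c"
  have "\<not> x extreme_point_of (convex hull P)"
  proof
    assume "x extreme_point_of (convex hull P)"
    then have "convex (convex hull P - {x})"
      using extreme_point_of_stillconvex[of "convex hull P" x] by (simp add: convex_convex_hull)
    moreover have "{a, b, c} \<subseteq> convex hull P - {x}"
      using abc hull_subset[of P convex] by (auto simp: enclosed_def)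
    ultimately have "convex hull {a, b, c} \<subseteq> convex hull P - {x}" by (simp add: hull_minimal)
    then show False using enclosed_in_hull[OF abc(4)] by auto
  qed
  then show "x \<in> interior_points P" using x by (simp add: interior_points_def extreme_points_def)
qed

text \<open>
  The order of the lines \<open>pv\<close>, \<open>pw\<close> by angle modulo \<open>\<pi>\<close>, measured from the line \<open>pq\<close>: the first two
  factors reflect points to the right of \<open>pq\<close> through \<open>p\<close>.
\<close>

definition before :: "real^2 \<Rightarrow> real^2 \<Rightarrow> real^2 \<Rightarrow> real^2 \<Rightarrow> bool" where
  "before p q v w \<longleftrightarrow> orientation p q v * orientation p q w * orientation p v w > 0"

lemma before_turn: "before p q v w \<longleftrightarrow> turn p q v * turn p q w * turn p v w > 0"
  unfolding before_def orientation_turn sgn_mult[symmetric] by simp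

lemma before_same_side:
  assumes "turn p q v * turn p q w > 0"
  shows "before p q v w \<longleftrightarrow> turn p v w > 0"
  unfolding before_turn zero_less_mult_iff[of "turn p q v * turn p q w"] using assms by auto

lemma before_other_side:
  assumes "turn p q v * turn p q w < 0"
  shows "before p q v w \<longleftrightarrow> turn p v w < 0"
  unfolding before_turn zero_less_mult_iff[of "turn p q v * turn p q w"] using assms by auto

text \<open>The marked points may be extreme themselves. Hence every simple configuration of at
  least two points with at most two interior points can be marked.\<close>

locale marked_config =
  fixes P :: "(real^2) set" and p q :: "real^2"
  assumes finite_P: "finite P" and simple: "simple_config P"
    and p_in: "p \<in> P" and q_in: "q \<in> P" and p_neq_q: "p \<noteq> q"
    and interior: "interior_points P \<subseteq> {p, q}"
begin

abbreviation "V \<equiv> P - {p, q}"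

lemma swap: "marked_config P q p"
  using finite_P simple p_in q_in p_neq_q interior by unfold_locales auto

lemma not_enclosed: "v \<in> V \<Longrightarrow> a \<in> P \<Longrightarrow> b \<in> P \<Longrightarrow> c \<in> P \<Longrightarrow> \<not> enclosed v a b c"
  using interior interior_points_iff[OF finite_P simple] by blast

lemma turn_pq: "v \<in> V \<Longrightarrow> turn p q v \<noteq> 0"
  using turn_nonzero[OF simple p_in q_in] p_neq_q by auto

lemma turn_p: "v \<in> V \<Longrightarrow> w \<in> V \<Longrightarrow> v \<noteq> w \<Longrightarrow> turn p v w \<noteq> 0"
  using turn_nonzero[OF simple p_in, of v w] by auto

lemma turn_q: "v \<in> V \<Longrightarrow> w \<in> V \<Longrightarrow> v \<noteq> w \<Longrightarrow> turn q v w \<noteq> 0"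
  using turn_nonzero[OF simple q_in, of v w] by auto

lemma before_irrefl: "irreflp_on V (before p q)"
  by (auto simp: irreflp_on_def before_turn)

lemma before_total: "totalp_on V (before p q)"
proof (rule totalp_onI)
  fix v w assume vw: "v \<in> V" "w \<in> V" "v \<noteq> w"
  then have "turn p q v * turn p q w * turn p v w \<noteq> 0"
    using turn_pq turn_p by simp
  then show "before p q v w \<or> before p q w v"
    unfolding before_turn turn_swap[of p w v] by (simp only: mult.commute[of "turn p q w"]) linarith
qed

lemma before_trans: "transp_on V (before p q)"
proof (rule transp_onI)
  fix v w x assume V: "v \<in> V" "w \<in> V" "x \<in> V" and b: "before p q v w" "before p q w x"
  define a b c where "a = turn p q v" and "b = turn p q w" and "c = turn p q x"
  have nz: "a \<noteq> 0" "b \<noteq> 0" "c \<noteq> 0" using V turn_pq by (auto simp: a_def b_def c_def)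
  \<comment> \<open>The Pluecker relation. Multiplied by \<open>a * b * c\<close>, its terms become
    squares times the products that \<open>before\<close> tests.\<close>
  have e: "b * turn p v x = a * turn p w x + c * turn p v w"
    using turn_plucker[of p q v w x] by (simp add: a_def b_def c_def)
  have "b\<^sup>2 * (a * c * turn p v x) = (a * b * c) * (b * turn p v x)"
    by (simp add: power2_eq_square)
  also have "\<dots> = a\<^sup>2 * (b * c * turn p w x) + c\<^sup>2 * (a * b * turn p v w)"
    unfolding e by (simp add: power2_eq_square algebra_simps)
  also have "\<dots> > 0"
    using b nz by (intro add_pos_pos mult_pos_pos[of "_\<^sup>2"]) (auto simp: before_turn a_def b_def c_def)
  finally show "before p q v x"
    using nz by (simp add: before_turn a_def b_def c_def zero_less_mult_iff)
qed

text \<open>If the orders about \<open>p\<close> and \<open>q\<close> disagreed, the extreme point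
  \<open>v\<close> would lie in the triangle \<open>p q w\<close>.\<close>

lemma turn_same_side_aux:
  assumes "v \<in> V" "w \<in> V" "turn p q v > 0" "turn p q w > 0" "turn p v w > 0"
  shows "turn q v w > 0"
proof (rule ccontr)
  assume "\<not> turn q v w > 0"
  moreover have "v \<noteq> w" using assms by auto
  ultimately have "turn q v w < 0" using turn_q[of v w] assms by fastforce
  moreover have "turn v p q = turn p q v" "turn v q w = - turn q v w" "turn v w p = turn p v w"
    by (simp_all add: turn_def algebra_simps)
  ultimately have "enclosed v p q w" using assms by (simp add: enclosed_def)
  then show False using not_enclosed assms p_in q_in by blast
qed

lemma turn_same_side:
  assumes "v \<in> V" "w \<in> V" "turn p q v > 0" "turn p q w > 0"
  shows "turn p v w > 0 \<longleftrightarrow> turn q v w > 0"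
proof
  show "turn p v w > 0 \<Longrightarrow> turn q v w > 0" using turn_same_side_aux assms by blast
next
  assume t: "turn q v w > 0"
  then have "v \<noteq> w" by auto
  show "turn p v w > 0"
  proof (rule ccontr)
    assume "\<not> turn p v w > 0"
    then have "turn p w v > 0" using turn_p[OF assms(1,2) \<open>v \<noteq> w\<close>] by (simp add: turn_swap[of p w v])
    then have "turn q w v > 0" using turn_same_side_aux assms by blast
    then show False using t by (simp add: turn_swap[of q w v])
  qed
qed

text \<open>The three points are sorted by angle about \<open>p\<close>; a clockwise turn would put
  the middle one, \<open>v\<close>, into the triangle \<open>p u w\<close>.\<close>

lemma turn_left_3:
  assumes "u \<in> V" "v \<in> V" "w \<in> V" "turn p u v > 0" "turn p v w > 0"
    and "turn p q u > 0" "turn p q v > 0" "turn p q w > 0"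
  shows "turn u v w > 0"
proof (rule ccontr)
  assume neg: "\<not> turn u v w > 0"
  have "before p q u v" "before p q v w" using assms by (simp_all add: before_turn)
  then have "before p q u w" using before_trans assms(1,2,3) by (meson transp_onD)
  then have "u \<noteq> w" by (auto simp: before_turn)
  moreover have "u \<noteq> v" "v \<noteq> w" using assms by auto
  ultimately have "turn u v w \<noteq> 0" using turn_nonzero[OF simple, of u v w] assms by auto
  then have "turn u v w < 0" using neg by simp
  moreover have "turn v p u = turn p u v" "turn v u w = - turn u v w" "turn v w p = turn p v w"
    by (simp_all add: turn_def algebra_simps)
  ultimately have "enclosed v p u w" using assms by (simp add: enclosed_def)
  then show False using not_enclosed assms p_in q_in by blast
qed

text \<open>
  If \<open>l\<close> were on the wrong side of the line \<open>uv\<close>, then, depending on the side from which this line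
  meets \<open>pq\<close>, either \<open>u\<close> would lie in the triangle \<open>q l v\<close> or \<open>v\<close> in the triangle \<open>p u l\<close>.
\<close>

lemma turn_left_left_right:
  assumes V: "u \<in> V" "v \<in> V" "l \<in> V" and tp: "turn p u v > 0"
    and s: "turn p q u > 0" "turn p q v > 0" "turn p q l < 0"
  shows "turn u v l > 0"
proof (rule ccontr)
  assume neg: "\<not> turn u v l > 0"
  have tq: "turn q u v > 0" using turn_same_side V tp s by blast
  have "u \<noteq> v" using tp by auto
  moreover have "u \<noteq> l" "v \<noteq> l" using s by auto
  ultimately have "turn u v l \<noteq> 0" using turn_nonzero[OF simple, of u v l] V by auto
  then have neg: "turn u v l < 0" using neg by simp
  have "\<not> enclosed u q l v" "\<not> enclosed v p u l" using not_enclosed V p_in q_in by blast+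
  moreover have "turn q u v = turn u v q" "turn p u v = turn v p u"
    "turn u l v = - turn u v l" "turn v u l = - turn u v l" by (simp_all add: turn_def algebra_simps)
  ultimately have c: "turn u q l \<le> 0" "turn v l p \<le> 0"
    using neg tp tq by (auto simp: enclosed_def turn_rotate[of v q u] not_less)
  define X where "X = turn p u v"
  define b where "b = turn p l v"
  define s1 s2 sl where "s1 = turn p q u" and "s2 = turn p q v" and "sl = turn p q l"
  have pos: "s1 > 0" "s2 > 0" "s1 - sl > 0" "X > 0" using s tp by (simp_all add: s1_def s2_def sl_def X_def)
  have bge: "b \<ge> 0" using c(2) unfolding b_def by (simp add: turn_def algebra_simps)
  have X: "X > s2 - s1"
    using tq unfolding X_def s1_def s2_def turn_def by (simp add: algebra_simps)
  define a where "a = turn p u l"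
  \<comment> \<open>The Pluecker relation at \<open>p\<close>, used to eliminate \<open>a\<close>.
    Then \<open>1\<close> and \<open>2\<close> bound \<open>b\<close> from below and above, and
    together they contradict \<open>X > s2 - s1\<close>.\<close>
  have gp: "s2 * a = - s1 * b + sl * X"
    unfolding s1_def s2_def sl_def a_def b_def X_def turn_def by (simp add: algebra_simps)
  have uvl: "turn u v l = X - b - a"
    unfolding X_def b_def a_def turn_def by (simp add: algebra_simps)
  have ul: "a + s1 - sl \<ge> 0"
    using c(1) unfolding s1_def sl_def a_def turn_def by (simp add: algebra_simps)
  have "s2 * (X - b) < s2 * a" using neg uvl pos by simp
  then have 1: "b * (s2 - s1) > (s2 - sl) * X" unfolding gp by (simp add: algebra_simps)
  have "s2 * (a + s1 - sl) \<ge> 0" using ul pos by simp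
  then have 2: "s1 * b \<le> s2 * (s1 - sl) + sl * X" using gp by (simp add: algebra_simps)
  have "s2 - sl > 0" using s by (simp add: s2_def sl_def)
  then have "b * (s2 - s1) > 0" using 1 pos by (smt (verit) mult_pos_pos)
  then have d: "s2 - s1 > 0" using bge by (simp add: zero_less_mult_iff)
  have "s1 * ((s2 - sl) * X) < s1 * (b * (s2 - s1))" using 1 pos by simp
  also have "\<dots> = (s1 * b) * (s2 - s1)" by simp
  also have "\<dots> \<le> (s2 * (s1 - sl) + sl * X) * (s2 - s1)" using 2 d by (intro mult_right_mono) auto
  finally have "(s2 * (s1 - sl)) * X < (s2 * (s1 - sl)) * (s2 - s1)" by (simp add: algebra_simps)
  then have "X < s2 - s1" using pos by (simp add: mult_less_cancel_left)
  then show False using X by simp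
qed

text \<open>Splitting areas at \<open>q\<close> gives
  \<open>turn q l u = turn p l u + turn p q l - turn p q u\<close>, so a negative turn stays
  negative. This one-sided shift is what keeps the two lattice paths of a code from
  crossing.\<close>

lemma before_cross:
  assumes "turn p q u > 0" "turn p q l < 0" "before p q l u"
  shows "before q p l u"
proof -
  have n: "turn p q l * turn p q u < 0" using assms by (simp add: mult_less_0_iff)
  then have "turn p l u < 0" using assms(3) before_other_side by blast
  then have "turn q l u < 0" using assms(1,2) by (simp add: turn_def algebra_simps)
  then show ?thesis using n before_other_side[of q p l u] by (simp add: turn_swap'[of q p])
qed

lemma before_swap_left:
  assumes "u \<in> V" "v \<in> V" "turn p q u > 0" "turn p q v > 0"
  shows "before q p u v \<longleftrightarrow> before p q u v"
  using turn_same_side[OF assms] assms before_same_side[of p q u v] before_same_side[of q p u v]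
  by (simp add: turn_swap'[of q p])

end

section \<open>The code of a marked configuration\<close>

definition rank :: "('a \<Rightarrow> 'a \<Rightarrow> bool) \<Rightarrow> 'a set \<Rightarrow> 'a \<Rightarrow> nat" where
  "rank r V v = card {w \<in> V. r w v}"

lemma rank_less_iff:
  assumes "finite V" "irreflp_on V r" "transp_on V r" "totalp_on V r" "x \<in> V" "y \<in> V"
  shows "rank r V x < rank r V y \<longleftrightarrow> r x y"
proof -
  have less: "rank r V v < rank r V w" if "v \<in> V" "w \<in> V" "r v w" for v w
    unfolding rank_def
  proof (rule psubset_card_mono)
    have "{u \<in> V. r u v} \<subseteq> {u \<in> V. r u w}"
      using assms(3) that by (auto dest: transp_onD)
    moreover have "v \<in> {u \<in> V. r u w}" "v \<notin> {u \<in> V. r u v}"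
      using that assms(2) by (auto dest: irreflp_onD)
    ultimately show "{u \<in> V. r u v} \<subset> {u \<in> V. r u w}" by blast
  qed (use assms(1) in auto)
  show ?thesis
  proof
    assume l: "rank r V x < rank r V y"
    then have "x \<noteq> y" by auto
    then have "r x y \<or> r y x" using assms(4-) by (auto dest: totalp_onD)
    then show "r x y" using less[of y x] l assms(5,6) by auto
  qed (rule less[OF assms(5,6)])
qed

lemma rank_bij:
  assumes "finite V" "irreflp_on V r" "transp_on V r" "totalp_on V r"
  shows "bij_betw (rank r V) V {..<card V}"
proof -
  have inj: "inj_on (rank r V) V"
    using rank_less_iff[OF assms] assms(4) by (auto simp: inj_on_def dest: totalp_onD) (metis less_irrefl totalp_onD)
  have "rank r V x < card V" if "x \<in> V" for x
    unfolding rank_def using that assms(1,2) by (intro psubset_card_mono) (auto dest: irreflp_onD)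
  then have "rank r V ` V \<subseteq> {..<card V}" by auto
  then have "rank r V ` V = {..<card V}"
    using card_image[OF inj] by (intro card_subset_eq) auto
  then show ?thesis using inj by (simp add: bij_betw_def)
qed

lemma rank_image:
  assumes "bij_betw f V W" "\<And>x y. x \<in> V \<Longrightarrow> y \<in> V \<Longrightarrow> r' (f x) (f y) \<longleftrightarrow> r x y" "x \<in> V"
  shows "rank r' W (f x) = rank r V x"
proof -
  have "{w \<in> W. r' w (f x)} = f ` {v \<in> V. r v x}"
    using assms by (auto simp: bij_betw_def)
  moreover have "inj_on f {v \<in> V. r v x}"
    using assms(1) by (auto simp: bij_betw_def intro: inj_on_subset)
  ultimately show ?thesis by (simp add: rank_def card_image)
qed

text \<open>Both isomorphisms preserve positions, and a position determines the element.\<close>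

lemma order_iso_unique:
  assumes "finite W" "irreflp_on W r'" "transp_on W r'" "totalp_on W r'"
    and "bij_betw f V W" "\<And>x y. x \<in> V \<Longrightarrow> y \<in> V \<Longrightarrow> r' (f x) (f y) \<longleftrightarrow> r x y"
    and "bij_betw g V W" "\<And>x y. x \<in> V \<Longrightarrow> y \<in> V \<Longrightarrow> r' (g x) (g y) \<longleftrightarrow> r x y"
    and "x \<in> V"
  shows "f x = g x"
proof -
  have "rank r' W (f x) = rank r' W (g x)"
    using rank_image[of f V W r' r x] rank_image[of g V W r' r x] assms by simp
  moreover have "f x \<in> W" "g x \<in> W" using assms by (auto dest: bij_betwE)
  ultimately show ?thesis using rank_bij[OF assms(1-4)] by (auto simp: bij_betw_def inj_on_def)
qed

section \<open>Codes and their invariance\<close>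

definition left_of :: "(real^2) set \<Rightarrow> real^2 \<Rightarrow> real^2 \<Rightarrow> (real^2) set" where
  "left_of P p q = {v \<in> P - {p, q}. orientation p q v > 0}"

text \<open>Both components mark the points to the left of \<open>pq\<close>, also where the order
  is taken about \<open>q\<close>; so they have equal size and can be compared as paths.\<close>

definition code :: "(real^2) set \<Rightarrow> real^2 \<Rightarrow> real^2 \<Rightarrow> nat set \<times> nat set" where
  "code P p q = (rank (before p q) (P - {p, q}) ` left_of P p q,
                 rank (before q p) (P - {p, q}) ` left_of P p q)"

definition orientation_iso :: "(real^2 \<Rightarrow> real^2) \<Rightarrow> (real^2) set \<Rightarrow> (real^2) set \<Rightarrow> bool" where
  "orientation_iso f P Q \<longleftrightarrow> bij_betw f P Q \<and>
     (\<forall>a\<in>P. \<forall>b\<in>P. \<forall>c\<in>P. orientation (f a) (f b) (f c) = orientation a b c)"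

lemma same_order_type_iso: "same_order_type P Q \<longleftrightarrow> (\<exists>f. orientation_iso f P Q)"
  by (simp add: same_order_type_def orientation_iso_def)

text \<open>A code is built from orientations alone, so it is an invariant of the configuration with
  its two labelled points.\<close>

lemma code_iso:
  assumes "orientation_iso f P Q" "p \<in> P" "q \<in> P"
  shows "code Q (f p) (f q) = code P p q"
proof -
  have bij: "bij_betw f P Q"
    and o: "\<And>a b c. a \<in> P \<Longrightarrow> b \<in> P \<Longrightarrow> c \<in> P \<Longrightarrow> orientation (f a) (f b) (f c) = orientation a b c"
    using assms(1) by (auto simp: orientation_iso_def)
  have inj: "inj_on f P" and im: "f ` P = Q" using bij by (auto simp: bij_betw_def)
  have imV: "f ` (P - {p, q}) = Q - {f p, f q}"
    using inj assms(2,3) unfolding im[symmetric] by (auto simp: inj_on_def)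
  then have bijV: "bij_betw f (P - {p, q}) (Q - {f p, f q})"
    using inj by (auto simp: bij_betw_def intro: inj_on_subset)
  have left: "left_of Q (f p) (f q) = f ` left_of P p q"
    unfolding left_of_def imV[symmetric] using o assms(2,3) by auto
  have "rank (before (f p) (f q)) (Q - {f p, f q}) (f v) = rank (before p q) (P - {p, q}) v"
    "rank (before (f q) (f p)) (Q - {f p, f q}) (f v) = rank (before q p) (P - {p, q}) v"
    if "v \<in> P - {p, q}" for v
    using that o assms(2,3) by (auto intro!: rank_image[OF bijV] simp: before_def)
  then show ?thesis
    unfolding code_def left image_image by (auto simp: left_of_def intro!: image_cong)
qed

section \<open>The convex polygon of the unmarked points\<close>

context marked_config
begin

lemma left_of_turn: "left_of P p q = {v \<in> V. turn p q v > 0}"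
  by (simp add: left_of_def orientation_turn)

lemma left_of_swap: "left_of P q p = V - left_of P p q"
  using turn_pq by (fastforce simp: left_of_def orientation_turn turn_swap'[of q p])

lemmas rank_p_less = rank_less_iff[OF _ before_irrefl before_trans before_total]
lemmas rank_p_bij = rank_bij[OF _ before_irrefl before_trans before_total]

text \<open>
  Counterclockwise order along the convex polygon spanned by \<open>V\<close>, starting at the line \<open>pq\<close>.
\<close>

definition precedes :: "real^2 \<Rightarrow> real^2 \<Rightarrow> bool" where
  "precedes v w \<longleftrightarrow> (if v \<in> left_of P p q \<longleftrightarrow> w \<in> left_of P p q then before p q v w else v \<in> left_of P p q)"

lemma precedes_total: "v \<in> V \<Longrightarrow> w \<in> V \<Longrightarrow> v \<noteq> w \<Longrightarrow> precedes v w \<or> precedes w v"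
  using before_total by (auto simp: precedes_def dest: totalp_onD)

text \<open>Exchanging \<open>p\<close> and \<open>q\<close> exchanges the sides, so the case of two
  right points is the left case of the swapped configuration.\<close>

lemma before_swap:
  assumes "u \<in> V" "v \<in> V" "u \<in> left_of P p q \<longleftrightarrow> v \<in> left_of P p q"
  shows "before q p u v \<longleftrightarrow> before p q u v"
proof (cases "u \<in> left_of P p q")
  case True
  then show ?thesis using assms before_swap_left[of u v] by (auto simp: left_of_turn)
next
  case False
  interpret sw: marked_config P q p by (rule swap)
  have "u \<in> left_of P q p" "v \<in> left_of P q p" using left_of_swap assms False by auto
  then show ?thesis using sw.before_swap_left[of u v] assms
    by (auto simp: sw.left_of_turn insert_commute)
qed

text \<open>Left points come first, so there are four cases by the number of left points. With at
  most one of them, the configuration is viewed with \<open>p\<close> and \<open>q\<close>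
  exchanged, where right points become left points.\<close>

lemma turn_precedes:
  assumes V: "u \<in> V" "v \<in> V" "w \<in> V" and uv: "precedes u v" and vw: "precedes v w"
  shows "turn u v w > 0"
proof -
  interpret sw: marked_config P q p by (rule swap)
  have comm: "{q, p} = {p, q}" by auto
  have L: "x \<in> left_of P p q \<longleftrightarrow> turn p q x > 0" if "x \<in> V" for x using that by (simp add: left_of_turn)
  have R: "x \<notin> left_of P p q \<Longrightarrow> turn q p x > 0" if "x \<in> V" for x
    using that turn_pq[OF that] L[OF that] by (simp add: turn_swap'[of q p])
  have pp: "turn p x y > 0" if "x \<in> left_of P p q" "y \<in> left_of P p q" "before p q x y" for x y
    using that before_same_side[of p q x y] by (auto simp: left_of_turn)
  have qq: "turn q x y > 0"
    if "x \<in> V" "y \<in> V" "x \<notin> left_of P p q" "y \<notin> left_of P p q" "before p q x y" for x y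
  proof -
    have "turn q p x * turn q p y > 0" by (rule mult_pos_pos[OF R[OF that(1,3)] R[OF that(2,4)]])
    moreover have "before q p x y" using before_swap[OF that(1,2)] that(3-5) by argo
    ultimately show ?thesis using before_same_side by blast
  qed
  have prec: "(x \<in> left_of P p q \<longleftrightarrow> y \<in> left_of P p q) \<and> before p q x y
      \<or> x \<in> left_of P p q \<and> y \<notin> left_of P p q" if "precedes x y" for x y
    using that unfolding precedes_def by argo
  consider "u \<in> left_of P p q" "v \<in> left_of P p q" "w \<in> left_of P p q" "before p q u v" "before p q v w"
    | "u \<in> left_of P p q" "v \<in> left_of P p q" "w \<notin> left_of P p q" "before p q u v"
    | "u \<in> left_of P p q" "v \<notin> left_of P p q" "w \<notin> left_of P p q" "before p q v w"
    | "u \<notin> left_of P p q" "v \<notin> left_of P p q" "w \<notin> left_of P p q" "before p q u v" "before p q v w"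
    using prec[OF uv] prec[OF vw] by argo
  then show ?thesis
  proof cases
    case 1
    show ?thesis
      by (rule turn_left_3[OF V pp[OF 1(1,2,4)] pp[OF 1(2,3,5)]
        L[OF V(1), THEN iffD1, OF 1(1)] L[OF V(2), THEN iffD1, OF 1(2)] L[OF V(3), THEN iffD1, OF 1(3)]])
  next
    case 2
    have "turn p q w < 0" using 2(3) L[OF V(3)] turn_pq[OF V(3)] by linarith
    then show ?thesis
      by (rule turn_left_left_right[OF V pp[OF 2(1,2,4)]
        L[OF V(1), THEN iffD1, OF 2(1)] L[OF V(2), THEN iffD1, OF 2(2)]])
  next
    case 3
    have "turn q p u < 0" using 3(1) L[OF V(1)] by (simp add: turn_swap'[of q p])
    then have "turn v w u > 0"
      by (rule sw.turn_left_left_right[unfolded comm, OF V(2,3,1) qq[OF V(2,3) 3(2,3,4)]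
        R[OF V(2) 3(2)] R[OF V(3) 3(3)]])
    then show ?thesis by (simp add: turn_rotate[of v w u])
  next
    case 4
    show ?thesis
      by (rule sw.turn_left_3[unfolded comm, OF V qq[OF V(1,2) 4(1,2,4)] qq[OF V(2,3) 4(2,3,5)]
        R[OF V(1) 4(1)] R[OF V(2) 4(2)] R[OF V(3) 4(3)]])
  qed
qed

end

section \<open>Reconstruction of the order type from the code\<close>

lemma sgn_turn_perm:
  assumes "sgn (turn a' b' c') = sgn (turn a b c)"
  shows "sgn (turn b' c' a') = sgn (turn b c a)" "sgn (turn b' a' c') = sgn (turn b a c)"
  using assms
  by (simp_all add: turn_rotate[of b c a] turn_rotate[of b' c' a'] turn_swap'[of b a c]
    turn_swap'[of b' a' c'] sgn_minus)

text \<open>\<open>before\<close> tests a product of three nonzero signs, two of which are known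
  from the sides of \<open>v\<close> and \<open>w\<close>; so it reveals the third.\<close>

lemma sgn_turn_of_before:
  assumes "sgn (turn p' q' v') = sgn (turn p q v)" "sgn (turn p' q' w') = sgn (turn p q w)"
    and "turn p q v \<noteq> 0" "turn p q w \<noteq> 0" "turn p v w \<noteq> 0" "turn p' v' w' \<noteq> 0"
    and "before p' q' v' w' \<longleftrightarrow> before p q v w"
  shows "sgn (turn p' v' w') = sgn (turn p v w)"
proof -
  have *: "x = 1 \<or> x = - 1" if "y \<noteq> 0" "x = sgn y" for x y :: real
    using that by (auto simp: sgn_if)
  define a b c d where "a = sgn (turn p q v)" and "b = sgn (turn p q w)"
    and "c = sgn (turn p v w)" and "d = sgn (turn p' v' w')"
  have "a * b * d > 0 \<longleftrightarrow> a * b * c > 0"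
    using assms by (simp add: before_def orientation_turn a_def b_def c_def d_def)
  moreover have "a = 1 \<or> a = - 1" "b = 1 \<or> b = - 1" "c = 1 \<or> c = - 1" "d = 1 \<or> d = - 1"
    using assms(3-6) * by (auto simp: a_def b_def c_def d_def)
  ultimately have "d = c" by (elim disjE) simp_all
  then show ?thesis by (simp add: c_def d_def)
qed

text \<open>Matching positions about \<open>p\<close> gives a bijection \<open>g\<close>, and
  matching positions about \<open>q\<close> gives \<open>h\<close>; equal codes make both respect
  the sides of \<open>pq\<close>. They turn out to be equal, so a single bijection respects both
  angular orders and hence all orientations involving \<open>p\<close> or \<open>q\<close>. The
  remaining triples are governed by \<open>turn_precedes\<close>.\<close>

lemma order_type_of_code:
  assumes "marked_config P p q" "marked_config P' p' q'" "card P = card P'" "code P p q = code P' p' q'"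
  shows "same_order_type P P'"
proof -
  interpret M: marked_config P p q by fact
  interpret M': marked_config P' p' q' by fact
  interpret S: marked_config P q p by (rule M.swap)
  interpret S': marked_config P' q' p' by (rule M'.swap)
  let ?L = "left_of P p q" and ?L' = "left_of P' p' q'"
  have fin: "finite M.V" "finite M'.V" using M.finite_P M'.finite_P by auto
  have cV: "card M.V = card M'.V"
    using M.finite_P M.p_in M.q_in M.p_neq_q M'.finite_P M'.p_in M'.q_in M'.p_neq_q assms(3)
    by (simp add: card_Diff_subset)
  have comm: "{q, p} = {p, q}" "{q', p'} = {p', q'}" by auto
  define rp where "rp = rank (before p q) M.V"
  define rq where "rq = rank (before q p) M.V"
  define rp' where "rp' = rank (before p' q') M'.V"
  define rq' where "rq' = rank (before q' p') M'.V"
  have bp: "bij_betw rp M.V {..<card M.V}" unfolding rp_def by (rule M.rank_p_bij[OF fin(1)])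
  have bp': "bij_betw rp' M'.V {..<card M.V}" unfolding rp'_def cV by (rule M'.rank_p_bij[OF fin(2)])
  have bq: "bij_betw rq M.V {..<card M.V}" unfolding rq_def
    using S.rank_p_bij[unfolded comm, OF fin(1)] .
  have bq': "bij_betw rq' M'.V {..<card M.V}" unfolding rq'_def cV
    using S'.rank_p_bij[unfolded comm, OF fin(2)] .
  have code: "rp ` ?L = rp' ` ?L'" "rq ` ?L = rq' ` ?L'"
    using assms(4) by (simp_all add: code_def rp_def rp'_def rq_def rq'_def)
  have Lsub: "?L \<subseteq> M.V" "?L' \<subseteq> M'.V" by (auto simp: left_of_def)
  have iso: "\<exists>g. bij_betw g M.V M'.V \<and> (\<forall>v\<in>M.V. r' (g v) = r v) \<and> (\<forall>v\<in>M.V. g v \<in> ?L' \<longleftrightarrow> v \<in> ?L)"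
    if b: "bij_betw r M.V {..<card M.V}" "bij_betw r' M'.V {..<card M.V}" and im: "r ` ?L = r' ` ?L'" for r r'
  proof -
    define g where "g = inv_into M'.V r' \<circ> r"
    have 1: "bij_betw g M.V M'.V" unfolding g_def using b bij_betw_inv_into bij_betw_trans by blast
    have 2: "r' (g v) = r v" if "v \<in> M.V" for v
      unfolding g_def comp_def by (rule bij_betw_inv_into_right[OF b(2)]) (use that b(1) bij_betwE in blast)
    have 3: "g v \<in> ?L' \<longleftrightarrow> v \<in> ?L" if "v \<in> M.V" for v
    proof -
      have gv: "g v \<in> M'.V" using 1 that bij_betwE by blast
      have "g v \<in> ?L' \<longleftrightarrow> r' (g v) \<in> r' ` ?L'"
        using inj_on_image_mem_iff[OF bij_betw_imp_inj_on[OF b(2)] gv Lsub(2)] by simp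
      also have "\<dots> \<longleftrightarrow> r v \<in> r ` ?L" using im 2 that by simp
      also have "\<dots> \<longleftrightarrow> v \<in> ?L"
        using inj_on_image_mem_iff[OF bij_betw_imp_inj_on[OF b(1)] that Lsub(1)] by simp
      finally show ?thesis .
    qed
    show ?thesis using 1 2 3 by blast
  qed
  obtain g where g: "bij_betw g M.V M'.V" "\<And>v. v \<in> M.V \<Longrightarrow> rp' (g v) = rp v"
    "\<And>v. v \<in> M.V \<Longrightarrow> g v \<in> ?L' \<longleftrightarrow> v \<in> ?L"
    using iso[OF bp bp' code(1)] by blast
  obtain h where h: "bij_betw h M.V M'.V" "\<And>v. v \<in> M.V \<Longrightarrow> rq' (h v) = rq v"
    "\<And>v. v \<in> M.V \<Longrightarrow> h v \<in> ?L' \<longleftrightarrow> v \<in> ?L"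
    using iso[OF bq bq' code(2)] by blast
  have gV: "g v \<in> M'.V" if "v \<in> M.V" for v using g(1) that bij_betwE by blast
  have hV: "h v \<in> M'.V" if "v \<in> M.V" for v using h(1) that bij_betwE by blast
  have gb: "before p' q' (g v) (g w) \<longleftrightarrow> before p q v w" if "v \<in> M.V" "w \<in> M.V" for v w
    using M.rank_p_less[OF fin(1) that] M'.rank_p_less[OF fin(2) gV[OF that(1)] gV[OF that(2)]] g(2) that
    by (simp add: rp_def rp'_def)
  have hb: "before q' p' (h v) (h w) \<longleftrightarrow> before q p v w" if "v \<in> M.V" "w \<in> M.V" for v w
    using S.rank_p_less[unfolded comm, OF fin(1) that] S'.rank_p_less[unfolded comm, OF fin(2) hV[OF that(1)] hV[OF that(2)]] h(2) that
    by (simp add: rq_def rq'_def)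
  \<comment> \<open>\<open>C\<close> is one side of \<open>pq\<close>. There the orders about
    \<open>p\<close> and \<open>q\<close> agree, so \<open>g\<close> and \<open>h\<close> are
    isomorphisms between the same two finite linear orders.\<close>
  have part: "g v = h v" if v: "v \<in> C" and C: "C = ?L \<and> C' = ?L' \<or> C = M.V - ?L \<and> C' = M'.V - ?L'" for v C C'
  proof (rule order_iso_unique[where r = "before p q" and r' = "before p' q'" and V = C and W = C' and f = g and g = h and x = v])
    have CV: "C \<subseteq> M.V" "C' \<subseteq> M'.V" using C Lsub by auto
    show "finite C'" using CV fin finite_subset by blast
    show "irreflp_on C' (before p' q')" by (rule irreflp_on_subset[OF M'.before_irrefl CV(2)])
    show "transp_on C' (before p' q')" by (rule transp_on_subset[OF M'.before_trans CV(2)])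
    show "totalp_on C' (before p' q')" by (rule totalp_on_subset[OF M'.before_total CV(2)])
    have bij: "bij_betw k C C'" if k: "bij_betw k M.V M'.V" "\<And>v. v \<in> M.V \<Longrightarrow> k v \<in> ?L' \<longleftrightarrow> v \<in> ?L" for k
    proof -
      have "k ` C = C'"
      proof (intro equalityI subsetI)
        fix y assume "y \<in> k ` C"
        then show "y \<in> C'" using C k CV bij_betwE[OF k(1)] by auto
      next
        fix y assume y: "y \<in> C'"
        then obtain x where "x \<in> M.V" "y = k x" using CV(2) bij_betw_imp_surj_on[OF k(1)] by blast
        then show "y \<in> k ` C" using C k y by auto
      qed
      then show ?thesis using k(1) CV(1) inj_on_subset by (auto simp: bij_betw_def)
    qed
    show "bij_betw g C C'" using bij g by blast
    show "bij_betw h C C'" using bij h by blast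
    show "v \<in> C" by fact
    fix x y assume xy: "x \<in> C" "y \<in> C"
    then have xyV: "x \<in> M.V" "y \<in> M.V" using CV by auto
    show "before p' q' (g x) (g y) \<longleftrightarrow> before p q x y" by (rule gb[OF xyV])
    have "x \<in> ?L \<longleftrightarrow> y \<in> ?L" using C xy by auto
    then show "before p' q' (h x) (h y) \<longleftrightarrow> before p q x y"
      using hb[OF xyV] M.before_swap[OF xyV] M'.before_swap[OF hV[OF xyV(1)] hV[OF xyV(2)]] h(3) xyV by blast
  qed
  have gh: "g v = h v" if "v \<in> M.V" for v
    using part[of v ?L ?L'] part[of v "M.V - ?L" "M'.V - ?L'"] that by blast
  define f where "f x = (if x = p then p' else if x = q then q' else g x)" for x
  have fp: "f p = p'" "f q = q'" using M.p_neq_q by (simp_all add: f_def)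
  have fV: "f v = g v" if "v \<in> M.V" for v using that by (simp add: f_def)
  have "bij_betw f M.V M'.V" using g(1) bij_betw_cong[of M.V f g M'.V] fV by blast
  moreover have "bij_betw f {p, q} {p', q'}"
    using M.p_neq_q M'.p_neq_q fp by (auto simp: bij_betw_def)
  ultimately have "bij_betw f (M.V \<union> {p, q}) (M'.V \<union> {p', q'})" by (rule bij_betw_combine) auto
  moreover have "M.V \<union> {p, q} = P" "M'.V \<union> {p', q'} = P'"
    using M.p_in M.q_in M'.p_in M'.q_in by auto
  ultimately have bf: "bij_betw f P P'" by simp
  \<comment> \<open>\<open>E\<close> is invariant under permutations of its arguments, so one
    arrangement of each triple has to be checked.\<close>
  define E where "E a b c \<longleftrightarrow> sgn (turn (f a) (f b) (f c)) = sgn (turn a b c)" for a b c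
  have E_perm: "E b c a" "E b a c" if "E a b c" for a b c
    using sgn_turn_perm[OF that[unfolded E_def]] unfolding E_def .
  have E_sort: "E a b c"
    if "E a b c \<or> E a c b \<or> E b a c \<or> E b c a \<or> E c a b \<or> E c b a" for a b c
    using that E_perm(1)[OF E_perm(2)[of a c b]] E_perm(2)[of b a c] E_perm(1)[OF E_perm(1)[of b c a]]
      E_perm(1)[of c a b] E_perm(2)[OF E_perm(1)[of c b a]] by argo
  have E_eq: "E a b c" if "a = b \<or> b = c \<or> a = c" for a b c
    using that by (auto simp: E_def)
  have E_pq: "E p q v" if "v \<in> M.V" for v
  proof (cases "v \<in> ?L")
    case True
    then have "g v \<in> ?L'" using g(3) that by blast
    then show ?thesis using True fp fV[OF that] by (simp add: E_def M.left_of_turn M'.left_of_turn)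
  next
    case False
    then have "g v \<notin> ?L'" using g(3) that by blast
    then have "turn p' q' (g v) < 0" using M'.turn_pq[OF gV[OF that]] gV[OF that] by (auto simp: M'.left_of_turn)
    moreover have "turn p q v < 0" using M.turn_pq[OF that] that False by (auto simp: M.left_of_turn)
    ultimately show ?thesis using fp fV[OF that] by (simp add: E_def)
  qed
  have g_neq: "g v \<noteq> g w" if "v \<in> M.V" "w \<in> M.V" "v \<noteq> w" for v w
    using inj_onD[OF bij_betw_imp_inj_on[OF g(1)]] that by blast
  have Eg_pq: "sgn (turn p' q' (g v)) = sgn (turn p q v)" if "v \<in> M.V" for v
    using E_pq[OF that] unfolding E_def fp fV[OF that] .
  have Eg_qp: "sgn (turn q' p' (g v)) = sgn (turn q p v)" if "v \<in> M.V" for v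
    using Eg_pq[OF that] unfolding turn_swap'[of q p] turn_swap'[of q' p'] sgn_minus by simp
  have E_p: "E p v w" if vw: "v \<in> M.V" "w \<in> M.V" "v \<noteq> w" for v w
    unfolding E_def fp fV[OF vw(1)] fV[OF vw(2)]
    by (rule sgn_turn_of_before[OF Eg_pq[OF vw(1)] Eg_pq[OF vw(2)] M.turn_pq[OF vw(1)]
      M.turn_pq[OF vw(2)] M.turn_p[OF vw] M'.turn_p[OF gV[OF vw(1)] gV[OF vw(2)] g_neq[OF vw]]
      gb[OF vw(1,2)]])
  have E_q: "E q v w" if vw: "v \<in> M.V" "w \<in> M.V" "v \<noteq> w" for v w
    unfolding E_def fp fV[OF vw(1)] fV[OF vw(2)]
    by (rule sgn_turn_of_before[OF Eg_qp[OF vw(1)] Eg_qp[OF vw(2)] S.turn_pq[unfolded comm, OF vw(1)]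
      S.turn_pq[unfolded comm, OF vw(2)] M.turn_q[OF vw] M'.turn_q[OF gV[OF vw(1)] gV[OF vw(2)] g_neq[OF vw]]
      hb[OF vw(1,2), folded gh[OF vw(1)] gh[OF vw(2)]]])
  have prec: "M'.precedes (g v) (g w)" if "M.precedes v w" "v \<in> M.V" "w \<in> M.V" for v w
    using that(1) unfolding M.precedes_def M'.precedes_def gb[OF that(2,3)] g(3)[OF that(2)] g(3)[OF that(3)] .
  have E_prec: "E u v w" if "u \<in> M.V" "v \<in> M.V" "w \<in> M.V" "M.precedes u v" "M.precedes v w" for u v w
    using M.turn_precedes[OF that] M'.turn_precedes[OF gV[OF that(1)] gV[OF that(2)] gV[OF that(3)]]
      prec[of u v] prec[of v w] that fV by (simp add: E_def)
  have E_V: "E u v w" if V: "u \<in> M.V" "v \<in> M.V" "w \<in> M.V" for u v w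
  proof (cases "u = v \<or> v = w \<or> u = w")
    case False
    then have "M.precedes u v \<or> M.precedes v u" "M.precedes v w \<or> M.precedes w v"
      "M.precedes u w \<or> M.precedes w u" using V M.precedes_total by auto
    then show ?thesis
      using E_prec[OF V] E_prec[OF V(1,3,2)] E_prec[OF V(2,1,3)] E_prec[OF V(2,3,1)]
        E_prec[OF V(3,1,2)] E_prec[OF V(3,2,1)] E_sort[of u v w] by argo
  qed (rule E_eq)
  have swap: "E a c b" if "E a b c" for a b c by (rule E_perm(1)[OF E_perm(2)[OF that]])
  have P: "x = p \<or> x = q \<or> x \<in> M.V" if "x \<in> P" for x using that by blast
  have Ep: "E p a b" if ab: "a \<in> P" "b \<in> P" for a b
    using P[OF ab(1)] P[OF ab(2)] E_eq[of p a b] E_pq[of b] swap[OF E_pq[of a]] E_p[of a b] by metis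
  have Eq: "E q a b" if ab: "a \<in> P" "b \<in> P" for a b
    using P[OF ab(1)] P[OF ab(2)] E_eq[of q a b] E_perm(2)[OF E_pq[of b]] E_perm(1)[OF E_pq[of a]]
      E_q[of a b] by metis
  have "E a b c" if abc: "a \<in> P" "b \<in> P" "c \<in> P" for a b c
    using P[OF abc(1)] P[OF abc(2)] P[OF abc(3)] E_V[of a b c]
      Ep[OF abc(2,3)] E_perm(1)[OF E_perm(1)[OF Ep[OF abc(3,1)]]] E_perm(1)[OF Ep[OF abc(1,2)]]
      Eq[OF abc(2,3)] E_perm(1)[OF E_perm(1)[OF Eq[OF abc(3,1)]]] E_perm(1)[OF Eq[OF abc(1,2)]]
    by metis
  then have "orientation_iso f P P'"
    using bf by (simp add: orientation_iso_def orientation_turn E_def)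
  then show ?thesis using same_order_type_iso by blast
qed

section \<open>Counting codes\<close>

text \<open>
  Pairs of lattice paths of length \<open>n\<close>, given by the positions of their up-steps, such that the
  first stays weakly above the second and ends at height \<open>h\<close> above it.
\<close>

definition codes :: "nat \<Rightarrow> nat \<Rightarrow> (nat set \<times> nat set) set" where
  "codes n h = {(A, B). A \<subseteq> {..<n} \<and> B \<subseteq> {..<n} \<and> card A = card B + h \<and>
     (\<forall>t\<le>n. card (B \<inter> {..<t}) \<le> card (A \<inter> {..<t}))}"

lemma finite_codes: "finite (codes n h)"
  by (rule finite_subset[of _ "Pow {..<n} \<times> Pow {..<n}"]) (auto simp: codes_def)

lemma codes_0: "codes 0 h = (if h = 0 then {({}, {})} else {})"
  by (auto simp: codes_def)

definition extend :: "nat \<Rightarrow> bool \<Rightarrow> nat set \<Rightarrow> nat set" where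
  "extend n a A = (if a then insert n A else A)"

text \<open>Prefixes of length at most \<open>n\<close> do not see the new step, and the condition
  at full length follows from the height equation.\<close>

lemma codes_extend:
  assumes "A \<subseteq> {..<n}" "B \<subseteq> {..<n}"
  shows "(extend n a A, extend n b B) \<in> codes (Suc n) h \<longleftrightarrow>
    card A + of_bool a = card B + of_bool b + h \<and> (\<forall>t\<le>n. card (B \<inter> {..<t}) \<le> card (A \<inter> {..<t}))"
proof -
  have card: "card (extend n c C) = card C + of_bool c" if "C \<subseteq> {..<n}" for c C
  proof -
    have "finite C" using that finite_subset by blast
    moreover have "n \<notin> C" using that by auto
    ultimately show ?thesis by (simp add: extend_def)
  qed
  have low: "extend n c C \<inter> {..<t} = C \<inter> {..<t}" if "t \<le> n" for c C t
    using that by (auto simp: extend_def)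
  have sub: "extend n c C \<subseteq> {..<Suc n}" if "C \<subseteq> {..<n}" for c C
    using that by (auto simp: extend_def)
  then have top: "extend n c C \<inter> {..<Suc n} = extend n c C" if "C \<subseteq> {..<n}" for c C
    using that by blast
  show ?thesis
    using assms by (auto simp: codes_def le_Suc_eq card low top sub)
qed

lemma codes_extend_image:
  assumes "h' + of_bool a = h + of_bool b"
  shows "map_prod (extend n a) (extend n b) ` codes n h' =
    {(A, B) \<in> codes (Suc n) h. (n \<in> A \<longleftrightarrow> a) \<and> (n \<in> B \<longleftrightarrow> b)}" (is "?L = ?R")
proof (intro equalityI subsetI)
  fix x assume "x \<in> ?L"
  then obtain A B where AB: "(A, B) \<in> codes n h'" and x: "x = (extend n a A, extend n b B)" by auto
  then have sub: "A \<subseteq> {..<n}" "B \<subseteq> {..<n}" by (auto simp: codes_def)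
  then have "n \<in> extend n a A \<longleftrightarrow> a" "n \<in> extend n b B \<longleftrightarrow> b" by (auto simp: extend_def)
  moreover have "(extend n a A, extend n b B) \<in> codes (Suc n) h"
    using AB assms codes_extend[OF sub, of a b h] by (simp add: codes_def)
  ultimately show "x \<in> ?R" unfolding x by simp
next
  fix x assume "x \<in> ?R"
  then obtain A B where AB: "(A, B) \<in> codes (Suc n) h" "n \<in> A \<longleftrightarrow> a" "n \<in> B \<longleftrightarrow> b" and x: "x = (A, B)" by auto
  have sub: "A - {n} \<subseteq> {..<n}" "B - {n} \<subseteq> {..<n}" using AB(1) by (auto simp: codes_def less_Suc_eq)
  have e: "extend n a (A - {n}) = A" "extend n b (B - {n}) = B" using AB by (auto simp: extend_def)
  have "(A - {n}, B - {n}) \<in> codes n h'"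
    using codes_extend[OF sub, of a b h] AB(1) assms sub unfolding e by (simp add: codes_def)
  then show "x \<in> ?L" unfolding x using e by (metis imageI map_prod_simp)
qed

lemma card_codes_extend:
  "card (map_prod (extend n a) (extend n b) ` codes n h) = card (codes n h)"
proof (rule card_image)
  have "inj_on (extend n c) (Pow {..<n})" for c
    by (auto simp: inj_on_def extend_def)
  then have "inj_on (map_prod (extend n a) (extend n b)) (Pow {..<n} \<times> Pow {..<n})"
    by (intro map_prod_inj_on)
  then show "inj_on (map_prod (extend n a) (extend n b)) (codes n h)"
    by (rule inj_on_subset) (auto simp: codes_def)
qed

text \<open>Split by the last step of both paths. Equal steps keep the height, whence the factor 2;
  different steps change it by one. Height 0 is never reached by an up-step of the first path alone,
  since that path would have been below the second one before.\<close>

lemma card_codes_Suc: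
  "card (codes (Suc n) h) = 2 * card (codes n h) + card (codes n (Suc h))
     + (if h = 0 then 0 else card (codes n (h - 1)))"
proof -
  define R where "R a b = {(A, B) \<in> codes (Suc n) h. (n \<in> A \<longleftrightarrow> a) \<and> (n \<in> B \<longleftrightarrow> b)}" for a b
  have fin: "finite (R a b)" for a b
    by (rule finite_subset[OF _ finite_codes[of "Suc n" h]]) (auto simp: R_def)
  have card: "card (R a b) = card (codes n h')" if "h' + of_bool a = h + of_bool b" for a b h'
    using codes_extend_image[OF that, of n] card_codes_extend[of n a b h'] by (simp add: R_def)
  have TF: "card (R True False) = (if h = 0 then 0 else card (codes n (h - 1)))"
  proof (cases "h = 0")
    case True
    have "R True False = {}"
    proof (rule ccontr)
      assume "R True False \<noteq> {}"
      then obtain A B where AB: "(A, B) \<in> codes (Suc n) h" "n \<in> A" "n \<notin> B" by (auto simp: R_def)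
      have fin: "finite A" using AB by (auto simp: codes_def intro: finite_subset)
      have "B \<inter> {..<n} = B" "A \<inter> {..<n} = A - {n}"
        using AB by (auto simp: codes_def less_Suc_eq)
      moreover have "card (B \<inter> {..<n}) \<le> card (A \<inter> {..<n})" "card A = card B"
        using AB True by (auto simp: codes_def)
      moreover have "card A > 0" using AB(2) fin card_gt_0_iff by blast
      ultimately show False using AB(2) by (simp add: card_Diff_singleton)
    qed
    then show ?thesis using True by simp
  next
    case False
    then show ?thesis using card[of "h - 1" True False] by simp
  qed
  have "codes (Suc n) h = (R True True \<union> R False False) \<union> (R False True \<union> R True False)"
    by (auto simp: R_def)
  moreover have "card ((R True True \<union> R False False) \<union> (R False True \<union> R True False)) =
      card (R True True) + card (R False False) + (card (R False True) + card (R True False))"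
  proof -
    have dis: "R a b \<inter> R a' b' = {}" if "a \<noteq> a' \<or> b \<noteq> b'" for a b a' b'
      using that by (auto simp: R_def)
    then show ?thesis using fin by (simp add: card_Un_disjoint Int_Un_distrib Int_Un_distrib2)
  qed
  ultimately show ?thesis using card[of h True True] card[of h False False] card[of "Suc h" False True] TF
    by simp
qed

text \<open>
  One step of both paths changes their height difference like two steps of a simple walk with steps
  \<open>\<plusminus>1/2\<close>, so these are ballot numbers for \<open>2n + 1\<close> steps.
\<close>

lemma card_codes:
  "int (card (codes n h)) = int (2 * n + 1 choose (n + h + 1)) - int (2 * n + 1 choose (n + h + 2))"
proof (induction n arbitrary: h)
  case 0
  show ?case by (cases h) (auto simp: codes_0)
next
  case (Suc n)
  have pascal2: "2 * Suc n + 1 choose (Suc (Suc k)) =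
      (2 * n + 1 choose Suc (Suc k)) + 2 * (2 * n + 1 choose Suc k) + (2 * n + 1 choose k)" for k
    by simp
  show ?case
  proof (cases h)
    case 0
    \<comment> \<open>At height -1 the claimed formula would give 0 by this symmetry, in accordance
      with the missing term of the recursion.\<close>
    have "2 * n + 1 choose n = 2 * n + 1 choose Suc n"
      using binomial_symmetric[of n "2 * n + 1"] by simp
    then show ?thesis using 0 pascal2[of n] pascal2[of "Suc n"]
      by (simp only: card_codes_Suc Suc.IH of_nat_add of_nat_mult) (simp add: Suc.IH del: binomial_Suc_Suc)
  next
    case (Suc k)
    then show ?thesis using pascal2[of "n + h"] pascal2[of "n + h + 1"]
      by (simp only: card_codes_Suc Suc.IH of_nat_add of_nat_mult) (simp add: Suc.IH del: binomial_Suc_Suc)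
  qed
qed

text \<open>The difference of the two adjacent binomials is the Catalan number with index
  \<open>n + 1\<close>, here with the denominator cleared.\<close>

lemma card_codes_0: "(n + 2) * card (codes n 0) = (2 * (n + 1)) choose (n + 1)"
proof -
  define x where "x = 2 * n + 1 choose (n + 1)"
  define y where "y = 2 * n + 1 choose (n + 2)"
  have "Suc (n + 1) * (2 * n + 1 choose Suc (n + 1)) = (2 * n + 1 - (n + 1)) * (2 * n + 1 choose (n + 1))"
    unfolding binomial_absorb_comp by (simp add: binomial_absorption del: binomial_Suc_Suc mult_Suc)
  then have e: "(n + 2) * y = n * x" by (simp add: x_def y_def)
  have "2 * n + 1 choose n = x"
    unfolding x_def using binomial_symmetric[of n "2 * n + 1"] by simp
  then have c: "(2 * (n + 1)) choose (n + 1) = 2 * x"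
    by (simp add: x_def)
  have "int (card (codes n 0)) = int x - int y"
    using card_codes[of n 0] unfolding x_def y_def by (simp only: add_0_right)
  then have "int ((n + 2) * card (codes n 0)) = int (n + 2) * (int x - int y)"
    by (simp only: of_nat_mult)
  also have "\<dots> = int ((n + 2) * x) - int ((n + 2) * y)" by (simp add: algebra_simps)
  also have "\<dots> = int (2 * x)" unfolding e by (simp add: algebra_simps)
  finally show ?thesis unfolding c of_nat_eq_iff .
qed

section \<open>Bounds for central binomial coefficients\<close>

lemma central_binomial_Suc:
  "(m + 1) * ((2 * (m + 1)) choose (m + 1)) = 2 * (2 * m + 1) * ((2 * m) choose m)"
proof -
  have "2 * m + 1 choose Suc m = 2 * m + 1 choose m"
    using binomial_symmetric[of m "2 * m + 1"] by simp
  then have 1: "(2 * (m + 1)) choose (m + 1) = 2 * (2 * m + 1 choose Suc m)" by simp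
  have "Suc m * (Suc (2 * m) choose Suc m) = Suc (2 * m) * (2 * m choose m)"
    by (rule Suc_times_binomial)
  then show ?thesis unfolding 1 by (simp del: binomial_Suc_Suc)
qed

text \<open>The bound \<open>4^m / sqrt (2*m + 1)\<close>, squared to make the induction step
  polynomial: it comes down to \<open>(2*x + 1) * (2*x + 3) \<le> (2*x + 2)^2\<close>.\<close>

lemma central_binomial_square_upper: "real ((2 * m) choose m) ^ 2 * (2 * real m + 1) \<le> 16 ^ m"
proof (induction m)
  case (Suc m)
  define b b' where "b = real ((2 * m) choose m)" and "b' = real ((2 * (m + 1)) choose (m + 1))"
  define x where "x = real m"
  have "real ((m + 1) * ((2 * (m + 1)) choose (m + 1))) = real (2 * (2 * m + 1) * ((2 * m) choose m))"
    using central_binomial_Suc[of m] by (rule arg_cong)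
  then have r: "(x + 1) * b' = 2 * (2 * x + 1) * b" by (simp add: b_def b'_def x_def algebra_simps)
  have IH: "b\<^sup>2 * (2 * x + 1) \<le> 16 ^ m" using Suc by (simp add: b_def x_def)
  have "(x + 1)\<^sup>2 * (b'\<^sup>2 * (2 * x + 3)) = ((x + 1) * b')\<^sup>2 * (2 * x + 3)" by (simp add: power_mult_distrib)
  also have "\<dots> = (4 * (2 * x + 1) * (2 * x + 3)) * (b\<^sup>2 * (2 * x + 1))"
    unfolding r by (simp add: power2_eq_square algebra_simps)
  also have "\<dots> \<le> (16 * (x + 1)\<^sup>2) * (b\<^sup>2 * (2 * x + 1))"
  proof (rule mult_right_mono)
    show "4 * (2 * x + 1) * (2 * x + 3) \<le> 16 * (x + 1)\<^sup>2"
      by (simp add: power2_eq_square algebra_simps)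
  qed (simp add: x_def)
  also have "\<dots> \<le> (16 * (x + 1)\<^sup>2) * 16 ^ m"
    using IH by (intro mult_left_mono) auto
  finally have "(x + 1)\<^sup>2 * (b'\<^sup>2 * (2 * x + 3)) \<le> (x + 1)\<^sup>2 * 16 ^ Suc m" by (simp add: algebra_simps)
  then have "b'\<^sup>2 * (2 * x + 3) \<le> 16 ^ Suc m" by (simp add: x_def mult_le_cancel_left)
  then show ?case by (simp add: b'_def x_def add.commute del: binomial_Suc_Suc)
qed simp

text \<open>The bound \<open>4^m / (2 * sqrt m)\<close>, squared; the induction step comes down to
  \<open>4 * x * (x + 1) \<le> (2*x + 1)^2\<close>.\<close>

lemma central_binomial_square_lower:
  assumes "m \<ge> 1" shows "16 ^ m \<le> 4 * real m * real ((2 * m) choose m) ^ 2"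
  using assms
proof (induction m rule: nat_induct_at_least)
  case (Suc m)
  define b b' where "b = real ((2 * m) choose m)" and "b' = real ((2 * (m + 1)) choose (m + 1))"
  define x where "x = real m"
  have x: "x \<ge> 1" using Suc by (simp add: x_def)
  have "real ((m + 1) * ((2 * (m + 1)) choose (m + 1))) = real (2 * (2 * m + 1) * ((2 * m) choose m))"
    using central_binomial_Suc[of m] by (rule arg_cong)
  then have r: "(x + 1) * b' = 2 * (2 * x + 1) * b" by (simp add: b_def b'_def x_def algebra_simps)
  have IH: "16 ^ m \<le> 4 * x * b\<^sup>2" using Suc by (simp add: b_def x_def)
  have "(x + 1) * 16 ^ Suc m = (16 * (x + 1)) * 16 ^ m" by simp
  also have "\<dots> \<le> (16 * (x + 1)) * (4 * x * b\<^sup>2)" using IH x by (intro mult_left_mono) auto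
  also have "\<dots> = (64 * x * (x + 1)) * b\<^sup>2" by simp
  also have "\<dots> \<le> (16 * (2 * x + 1)\<^sup>2) * b\<^sup>2"
    by (intro mult_right_mono) (auto simp: power2_eq_square algebra_simps)
  also have "\<dots> = 4 * ((x + 1) * b')\<^sup>2" unfolding r by (simp add: power2_eq_square algebra_simps)
  also have "\<dots> = (x + 1) * (4 * (x + 1) * b'\<^sup>2)" by (simp add: power2_eq_square)
  finally have "16 ^ Suc m \<le> 4 * (x + 1) * b'\<^sup>2" using x by (simp add: mult_le_cancel_left)
  then show ?case by (simp add: b'_def x_def add.commute del: binomial_Suc_Suc)
qed simp

text \<open>Both inequalities are compared after squaring, which turns \<open>x powr (3/2)\<close>
  into \<open>x ^ 3\<close> and admits the squared binomial bounds via
  \<open>b = (x + 2) * c\<close>.\<close>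

lemma card_codes_bounds:
  assumes "n \<ge> 1"
  shows "real (card (codes n 0)) \<le> 4 * (4 ^ n / real n powr (3/2))"
    and "4 ^ n / real n powr (3/2) \<le> 4 * real (card (codes n 0))"
proof -
  define c where "c = real (card (codes n 0))"
  define x where "x = real n"
  have x: "x \<ge> 1" using assms by (simp add: x_def)
  define b where "b = real ((2 * (n + 1)) choose (n + 1))"
  have b: "(x + 2) * c = b"
    using arg_cong[OF card_codes_0[of n], of real]
    unfolding b_def c_def x_def by (simp only: of_nat_mult of_nat_add of_nat_numeral)
  have p: "(x powr (3/2))\<^sup>2 = x ^ 3" using x by (simp add: powr_power powr_numeral)
  have pos: "x powr (3/2) > 0" using x by simp
  have f: "(4::real) ^ k * 4 ^ k = 16 ^ k" for k by (simp add: power_mult_distrib[symmetric])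
  have U: "b\<^sup>2 * (2 * x + 3) \<le> 16 * 16 ^ n"
    using central_binomial_square_upper[of "n + 1"] by (simp add: b_def x_def add.commute del: binomial_Suc_Suc)
  have L: "16 * 16 ^ n \<le> 4 * (x + 1) * b\<^sup>2"
    using central_binomial_square_lower[of "n + 1"] by (simp add: b_def x_def add.commute del: binomial_Suc_Suc)
  have "(c * x powr (3/2))\<^sup>2 = c\<^sup>2 * x ^ 3" using p by (simp add: power_mult_distrib)
  also have "\<dots> \<le> c\<^sup>2 * ((x + 2)\<^sup>2 * (2 * x + 3))"
    using x by (intro mult_left_mono) (auto simp: power2_eq_square power3_eq_cube algebra_simps)
  also have "\<dots> = b\<^sup>2 * (2 * x + 3)" unfolding b[symmetric] by (simp add: power2_eq_square)
  also have "\<dots> \<le> (4 * 4 ^ n)\<^sup>2" using U f[of n] by (simp add: power2_eq_square)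
  finally have "c * x powr (3/2) \<le> 4 * 4 ^ n" by (rule power2_le_imp_le) simp
  then show "real (card (codes n 0)) \<le> 4 * (4 ^ n / real n powr (3/2))"
    using pos by (simp add: c_def x_def pos_le_divide_eq)
  have "(2 * 4 ^ n)\<^sup>2 \<le> (x + 1) * (x + 2)\<^sup>2 * c\<^sup>2"
  proof -
    have "4 * (x + 1) * b\<^sup>2 = 4 * ((x + 1) * b\<^sup>2)" by (rule mult.assoc)
    then have "4 * 16 ^ n \<le> (x + 1) * b\<^sup>2" using L by linarith
    also have "\<dots> = (x + 1) * (x + 2)\<^sup>2 * c\<^sup>2" unfolding b[symmetric] by (simp add: power_mult_distrib)
    finally show ?thesis using f[of n] by (simp add: power2_eq_square)
  qed
  also have "\<dots> \<le> (4 * 9 * x ^ 3) * c\<^sup>2"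
  proof (rule mult_right_mono)
    have "(x + 1) * (x + 2)\<^sup>2 \<le> (2 * x) * (3 * x)\<^sup>2"
      using x by (intro mult_mono power_mono) auto
    also have "\<dots> = 18 * x ^ 3" by (simp add: power2_eq_square power3_eq_cube)
    also have "\<dots> \<le> 4 * 9 * x ^ 3" using x by simp
    finally show "(x + 1) * (x + 2)\<^sup>2 \<le> 4 * 9 * x ^ 3" .
  qed simp
  also have "\<dots> = (6 * (c * x powr (3/2)))\<^sup>2" using p by (simp add: power_mult_distrib)
  finally have "2 * 4 ^ n \<le> 6 * (c * x powr (3/2))"
    by (rule power2_le_imp_le) (use pos in \<open>simp add: c_def\<close>)
  moreover have "c * x powr (3/2) \<ge> 0" by (simp add: c_def)
  ultimately have "4 ^ n \<le> 4 * c * x powr (3/2)" by linarith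
  then show "4 ^ n / real n powr (3/2) \<le> 4 * real (card (codes n 0))"
    using pos by (simp add: c_def x_def pos_divide_le_eq)
qed

section \<open>Unit intervals with prescribed interleaving\<close>

text \<open>Density of the reals for finitely many constraints, used to place points one at a time.
  Inserting 0 provides a maximum or minimum when a set is empty.\<close>

lemma exists_between_finite:
  fixes A B :: "real set"
  assumes "finite A" "finite B" "\<And>a b. a \<in> A \<Longrightarrow> b \<in> B \<Longrightarrow> a < b"
  shows "\<exists>x. (\<forall>a\<in>A. a < x) \<and> (\<forall>b\<in>B. x < b)"
proof (cases "A = {} \<or> B = {}")
  case True
  then consider "B = {}" | "A = {}" by blast
  then show ?thesis
  proof cases
    case 1
    have "\<forall>a\<in>A. a < Max (insert 0 A) + 1"
      using Max_ge[of "insert 0 A"] assms(1) by (metis finite_insert insertCI le_less_trans less_add_one)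
    then show ?thesis using 1 by blast
  next
    case 2
    have "\<forall>b\<in>B. Min (insert 0 B) - 1 < b"
      using Min_le[of "insert 0 B"] assms(2) by (metis diff_add_cancel finite_insert insertCI less_add_one less_le_trans)
    then show ?thesis using 2 by blast
  qed
next
  case False
  then have "Max A < Min B" using assms by simp
  then obtain x where "Max A < x" "x < Min B" using dense by blast
  then show ?thesis using assms(1,2) False by (intro exI[of _ x]) simp
qed

definition monotone_below :: "nat \<Rightarrow> (nat \<Rightarrow> nat) \<Rightarrow> bool" where
  "monotone_below k a \<longleftrightarrow> (\<forall>i j. i \<le> j \<longrightarrow> j < k \<longrightarrow> a i \<le> a j)"

text \<open>
  As in the proof that proper interval graphs are unit interval graphs: the intervals are placed
  from left to right, and only the left end of the new one has to be fitted between the ends of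
  the old ones.
\<close>

lemma unit_interval_left_ends:
  assumes "monotone_below k a" "monotone_below k b" "\<And>i. i < k \<Longrightarrow> a i \<le> b i"
  shows "\<exists>y :: nat \<Rightarrow> real. \<forall>i<k. \<forall>j<k. (i < j \<longrightarrow> y i < y j) \<and> (b i < a j \<longrightarrow> y i + 1 < y j) \<and>
    (a i < b j \<longrightarrow> y i < y j + 1)"
  using assms
proof (induction k)
  case (Suc k)
  have am: "a i \<le> a j" "b i \<le> b j" if "i \<le> j" "j \<le> k" for i j
    using Suc.prems(1,2) that by (auto simp: monotone_below_def)
  have mk: "monotone_below k a" "monotone_below k b" using Suc.prems by (auto simp: monotone_below_def)
  have "\<And>i. i < k \<Longrightarrow> a i \<le> b i" using Suc.prems(3) by simp
  from Suc.IH[OF mk this] obtain y :: "nat \<Rightarrow> real" where y: "\<And>i j. i < k \<Longrightarrow> j < k \<Longrightarrow> i < j \<Longrightarrow> y i < y j"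
    "\<And>i j. i < k \<Longrightarrow> j < k \<Longrightarrow> b i < a j \<Longrightarrow> y i + 1 < y j"
    "\<And>i j. i < k \<Longrightarrow> j < k \<Longrightarrow> a i < b j \<Longrightarrow> y i < y j + 1" by blast
  \<comment> \<open>All constraints on the new left end: it exceeds the earlier left ends and the
    right ends that must come before it, and stays below the right ends that must come after
    it.\<close>
  define Lo where "Lo = y ` {..<k} \<union> (\<lambda>i. y i + 1) ` {i. i < k \<and> b i < a k}"
  define Up where "Up = (\<lambda>i. y i + 1) ` {i. i < k \<and> a k < b i}"
  have "l < u" if "l \<in> Lo" "u \<in> Up" for l u
  proof -
    obtain j where j: "j < k" "a k < b j" "u = y j + 1" using \<open>u \<in> Up\<close> by (auto simp: Up_def)
    from \<open>l \<in> Lo\<close> consider i where "i < k" "l = y i" | i where "i < k" "b i < a k" "l = y i + 1"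
      by (auto simp: Lo_def)
    then show ?thesis
    proof cases
      case 1
      then show ?thesis using y(3)[of i j] j am(1)[of i k] by auto
    next
      case 2
      \<comment> \<open>Here \<open>b i < a k < b j\<close>, so monotonicity orders the two old
        intervals.\<close>
      then have "\<not> b j \<le> b i" using j by linarith
      then have "i < j" using am(2)[of j i] 2 by (meson less_imp_le not_le)
      then show ?thesis using y(1)[of i j] 2 j by auto
    qed
  qed
  moreover have "finite Lo" "finite Up" by (auto simp: Lo_def Up_def)
  ultimately obtain Y where Y: "\<And>l. l \<in> Lo \<Longrightarrow> l < Y" "\<And>u. u \<in> Up \<Longrightarrow> Y < u"
    using exists_between_finite[of Lo Up] by blast
  have Y1: "y i < Y" if "i < k" for i using Y(1)[of "y i"] that by (auto simp: Lo_def)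
  have Y2: "y i + 1 < Y" if "i < k" "b i < a k" for i using Y(1)[of "y i + 1"] that by (auto simp: Lo_def)
  have Y3: "Y < y i + 1" if "i < k" "a k < b i" for i using Y(2)[of "y i + 1"] that by (auto simp: Up_def)
  show ?case
  proof (intro exI[of _ "y(k := Y)"] allI impI conjI)
    fix i j assume ij: "i < Suc k" "j < Suc k"
    show "(y(k := Y)) i < (y(k := Y)) j" if "i < j"
      using that ij y(1)[of i j] Y1[of i] by (auto simp: less_Suc_eq)
    show "(y(k := Y)) i + 1 < (y(k := Y)) j" if "b i < a j"
    proof -
      have "i < j"
      proof (rule ccontr)
        assume "\<not> i < j"
        then have "b j \<le> b i" using am(2)[of j i] ij by simp
        then show False using that Suc.prems(3)[OF ij(2)] by linarith
      qed
      then show ?thesis using that ij y(2)[of i j] Y2[of i] by (auto simp: less_Suc_eq)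
    qed
    show "(y(k := Y)) i < (y(k := Y)) j + 1" if "a i < b j"
      using that ij y(3)[of i j] Y3[of j] Y1[of i] by (auto simp: less_Suc_eq) 
  qed
qed simp

text \<open>The values \<open>a i\<close> and \<open>b i\<close> prescribe how many points precede
  the left and the right end of the unit interval at \<open>y i\<close>. Points are added from left
  to right; the hypotheses say that ends with different prescribed values are ordered accordingly,
  so the bounds on a new point are compatible.\<close>

lemma interleaved_points:
  fixes y :: "nat \<Rightarrow> real"
  assumes "\<And>i j. i < k \<Longrightarrow> j < k \<Longrightarrow> i < j \<Longrightarrow> y i < y j"
    "\<And>i j. i < k \<Longrightarrow> j < k \<Longrightarrow> b i < a j \<Longrightarrow> y i + 1 < y j"
    "\<And>i j. i < k \<Longrightarrow> j < k \<Longrightarrow> a i < b j \<Longrightarrow> y i < y j + 1"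
    and "monotone_below k a" "monotone_below k b"
  shows "\<exists>z. (\<forall>j<m. \<forall>i<k. (if j < a i then z j < y i else y i < z j) \<and>
      (if j < b i then z j < y i + 1 else y i + 1 < z j)) \<and> (\<forall>j<m. \<forall>j'<j. z j' < z j)"
proof (induction m)
  case (Suc m)
  then obtain z where z: "\<And>i j. j < m \<Longrightarrow> i < k \<Longrightarrow> (if j < a i then z j < y i else y i < z j)"
    "\<And>i j. j < m \<Longrightarrow> i < k \<Longrightarrow> (if j < b i then z j < y i + 1 else y i + 1 < z j)"
    "\<And>j j'. j < m \<Longrightarrow> j' < j \<Longrightarrow> z j' < z j" by blast
  have lt: "i < j" if "f i < f j" "monotone_below k f" "i < k" "j < k" for i j and f :: "nat \<Rightarrow> nat"
    using that unfolding monotone_below_def by (metis not_le)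
  define Lo where "Lo = z ` {..<m} \<union> y ` {i. i < k \<and> a i \<le> m} \<union> (\<lambda>i. y i + 1) ` {i. i < k \<and> b i \<le> m}"
  define Up where "Up = y ` {i. i < k \<and> m < a i} \<union> (\<lambda>i. y i + 1) ` {i. i < k \<and> m < b i}"
  have "l < u" if "l \<in> Lo" "u \<in> Up" for l u
  proof -
    from \<open>u \<in> Up\<close> consider j where "j < k" "m < a j" "u = y j" | j where "j < k" "m < b j" "u = y j + 1"
      by (auto simp: Up_def)
    then show ?thesis
    proof cases
      case 1
      from \<open>l \<in> Lo\<close> consider i where "i < m" "l = z i" | i where "i < k" "a i \<le> m" "l = y i"
        | i where "i < k" "b i \<le> m" "l = y i + 1" by (auto simp: Lo_def)
      then show ?thesis
      proof cases
        case (1 i)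
        then show ?thesis using z(1)[of i j] \<open>j < k\<close> \<open>m < a j\<close> \<open>u = y j\<close> by simp
      next
        case (2 i)
        then show ?thesis using assms(1)[of i j] lt[of a i j] assms(4) \<open>j < k\<close> \<open>m < a j\<close> \<open>u = y j\<close> by simp
      next
        case (3 i)
        then show ?thesis using assms(2)[of i j] \<open>j < k\<close> \<open>m < a j\<close> \<open>u = y j\<close> by simp
      qed
    next
      case 2
      from \<open>l \<in> Lo\<close> consider i where "i < m" "l = z i" | i where "i < k" "a i \<le> m" "l = y i"
        | i where "i < k" "b i \<le> m" "l = y i + 1" by (auto simp: Lo_def)
      then show ?thesis
      proof cases
        case (1 i)
        then show ?thesis using z(2)[of i j] \<open>j < k\<close> \<open>m < b j\<close> \<open>u = y j + 1\<close> by simp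
      next
        case (2 i)
        then show ?thesis using assms(3)[of i j] \<open>j < k\<close> \<open>m < b j\<close> \<open>u = y j + 1\<close> by simp
      next
        case (3 i)
        then show ?thesis using assms(1)[of i j] lt[of b i j] assms(5) \<open>j < k\<close> \<open>m < b j\<close> \<open>u = y j + 1\<close> by simp
      qed
    qed
  qed
  moreover have "finite Lo" "finite Up" by (auto simp: Lo_def Up_def)
  ultimately obtain Z where Z: "\<And>l. l \<in> Lo \<Longrightarrow> l < Z" "\<And>u. u \<in> Up \<Longrightarrow> Z < u"
    using exists_between_finite[of Lo Up] by blast
  have 1: "z j < Z" if "j < m" for j using Z(1)[of "z j"] that by (auto simp: Lo_def)
  have 2: "if m < a i then Z < y i else y i < Z" if "i < k" for i
    using Z(1)[of "y i"] Z(2)[of "y i"] that by (auto simp: Lo_def Up_def)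
  have 3: "if m < b i then Z < y i + 1 else y i + 1 < Z" if "i < k" for i
    using Z(1)[of "y i + 1"] Z(2)[of "y i + 1"] that by (auto simp: Lo_def Up_def)
  show ?case
    by (rule exI[of _ "z(m := Z)"]) (use 1 2 3 z in \<open>auto simp: less_Suc_eq\<close>)
qed simp

text \<open>\<open>a i\<close> counts the non-elements of \<open>A\<close> before its element number
  \<open>i\<close>, counting from 0. For a code, this is the number of right points before a left
  point.\<close>

lemma subset_enumeration:
  assumes "A \<subseteq> {..<n}"
  shows "\<exists>a. monotone_below (card A) a \<and> (\<forall>i<card A. a i \<le> n - card A) \<and> A = (\<lambda>i. i + a i) ` {..<card A}"
  using assms
proof (induction n arbitrary: A)
  case (Suc n)
  show ?case
  proof (cases "n \<in> A")
    case False
    then have "A \<subseteq> {..<n}" using Suc.prems by (auto simp: less_Suc_eq)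
    from Suc.IH[OF this] obtain a where a: "monotone_below (card A) a" "\<forall>i<card A. a i \<le> n - card A"
      "A = (\<lambda>i. i + a i) ` {..<card A}" by blast
    then have "\<forall>i<card A. a i \<le> Suc n - card A" by (meson diff_le_mono le_SucI le_refl le_trans)
    then show ?thesis using a by blast
  next
    case True
    define A' k where "A' = A - {n}" and "k = card A'"
    have sub: "A' \<subseteq> {..<n}" using Suc.prems by (auto simp: A'_def less_Suc_eq)
    have fin: "finite A" using Suc.prems finite_subset by blast
    have cA: "card A = Suc k" using True fin unfolding k_def A'_def by (rule card.remove[rotated])
    have "k \<le> n" using card_mono[OF _ sub] by (simp add: k_def)
    from Suc.IH[OF sub] obtain a where a: "monotone_below k a" "\<forall>i<k. a i \<le> n - k"
      "A' = (\<lambda>i. i + a i) ` {..<k}" unfolding k_def by blast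
    let ?a = "a(k := n - k)"
    have "monotone_below (Suc k) ?a" using a by (auto simp: monotone_below_def less_Suc_eq)
    moreover have "\<forall>i<Suc k. ?a i \<le> Suc n - Suc k" using a by (auto simp: less_Suc_eq)
    moreover have "A = (\<lambda>i. i + ?a i) ` {..<Suc k}"
    proof -
      have "A = insert n A'" using True by (auto simp: A'_def)
      also have "\<dots> = insert n ((\<lambda>i. i + ?a i) ` {..<k})" using a(3) by auto
      also have "\<dots> = (\<lambda>i. i + ?a i) ` {..<Suc k}" using \<open>k \<le> n\<close> by (simp add: lessThan_Suc)
      finally show ?thesis .
    qed
    ultimately show ?thesis unfolding cA by blast
  qed
qed (simp add: monotone_below_def)

lemma codes_enumeration:
  assumes "(A, B) \<in> codes n 0"
  obtains k a b where "k \<le> n" "monotone_below k a" "monotone_below k b" "\<And>i. i < k \<Longrightarrow> a i \<le> b i"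
    "\<And>i. i < k \<Longrightarrow> b i \<le> n - k" "A = (\<lambda>i. i + a i) ` {..<k}" "B = (\<lambda>i. i + b i) ` {..<k}"
proof -
  define k where "k = card A"
  have sub: "A \<subseteq> {..<n}" "B \<subseteq> {..<n}" and cB: "card B = k"
    and dom: "\<And>t. t \<le> n \<Longrightarrow> card (B \<inter> {..<t}) \<le> card (A \<inter> {..<t})"
    using assms by (auto simp: codes_def k_def)
  have kn: "k \<le> n" using card_mono[OF _ sub(1)] by (simp add: k_def)
  obtain a where a: "monotone_below k a" "A = (\<lambda>i. i + a i) ` {..<k}"
    using subset_enumeration[OF sub(1)] unfolding k_def by blast
  obtain b where b: "monotone_below k b" "\<And>i. i < k \<Longrightarrow> b i \<le> n - k" "B = (\<lambda>i. i + b i) ` {..<k}"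
    using subset_enumeration[OF sub(2)] unfolding cB by blast
  have "a i \<le> b i" if i: "i < k" for i
  proof (rule ccontr)
    assume "\<not> a i \<le> b i"
    then have lt: "b i < a i" by simp
    \<comment> \<open>The shortest prefix that reaches element number \<open>i\<close> of
      \<open>B\<close>: it has at least \<open>i + 1\<close> elements of \<open>B\<close> but at
      most \<open>i\<close> of \<open>A\<close>.\<close>
    define t where "t = Suc (i + b i)"
    have "(\<lambda>j. j + b j) ` {..i} \<subseteq> B \<inter> {..<t}"
      using b(1,3) i by (auto simp: monotone_below_def t_def less_Suc_eq_le intro!: add_mono)
    moreover have inj: "inj_on (\<lambda>j. j + b j) {..i}"
    proof (rule strict_mono_on_imp_inj_on, rule strict_mono_onI)
      fix r s assume "r \<in> {..i}" "s \<in> {..i}" "r < s"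
      then show "r + b r < s + b s" using b(1) i unfolding monotone_below_def
        by (intro add_less_le_mono) auto
    qed
    ultimately have "card {..i} \<le> card (B \<inter> {..<t})"
      by (metis card_image card_mono finite_Int finite_lessThan)
    moreover have "A \<inter> {..<t} \<subseteq> (\<lambda>j. j + a j) ` {..<i}"
    proof
      fix x assume "x \<in> A \<inter> {..<t}"
      then obtain j where j: "j < k" "x = j + a j" "j + a j < t" using a(2) by auto
      have "j < i"
      proof (rule ccontr)
        assume "\<not> j < i"
        then have "a i \<le> a j" "i \<le> j" using a(1) j(1) by (auto simp: monotone_below_def)
        then show False using j(3) lt by (simp add: t_def)
      qed
      then show "x \<in> (\<lambda>j. j + a j) ` {..<i}" using j by auto
    qed
    then have "card (A \<inter> {..<t}) \<le> i" using surj_card_le[of "{..<i}"] by fastforce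
    moreover have "t \<le> n" using b(2)[OF i] i kn by (simp add: t_def)
    ultimately show False using dom[of t] by simp
  qed
  then show ?thesis using that[OF kn a(1) b(1) _ b(2) a(2) b(3)] by simp
qed

section \<open>Realising codes on a parabola\<close>

definition parab :: "real \<Rightarrow> real^2" where "parab t = vector [t, t\<^sup>2]"
definition axis_pt :: "real \<Rightarrow> real^2" where "axis_pt c = vector [0, c]"

lemma coords: "parab t $ 1 = t" "parab t $ 2 = t\<^sup>2" "axis_pt c $ 1 = 0" "axis_pt c $ 2 = c"
  by (simp_all add: parab_def axis_pt_def)

text \<open>The chord through \<open>parab s\<close> and \<open>parab t\<close> meets the axis at
  height \<open>- s * t\<close>; the factor \<open>s * t + c\<close> says whether the axis point is
  above or below it.\<close>

lemma turn_parab: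
  "turn (parab r) (parab s) (parab t) = (s - r) * (t - r) * (t - s)"
  "turn (axis_pt c) (parab s) (parab t) = (t - s) * (s * t + c)"
  "turn (parab s) (axis_pt c) (parab t) = (s - t) * (s * t + c)"
  "turn (parab s) (parab t) (axis_pt c) = (t - s) * (s * t + c)"
  "turn (axis_pt c) (axis_pt d) (parab t) = (c - d) * t"
  "turn (axis_pt c) (parab t) (axis_pt d) = (d - c) * t"
  "turn (parab t) (axis_pt c) (axis_pt d) = (c - d) * t"
  by (simp_all add: turn_def coords power2_eq_square algebra_simps)

lemma parab_eq_iff [simp]: "parab s = parab t \<longleftrightarrow> s = t"
  using coords by metis

lemma axis_pt_eq_iff [simp]: "axis_pt c = axis_pt d \<longleftrightarrow> c = d"
  using coords by metis

lemma parab_neq_axis: "t \<noteq> 0 \<Longrightarrow> parab t \<noteq> axis_pt c" "t \<noteq> 0 \<Longrightarrow> axis_pt c \<noteq> parab t"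
  using coords by metis+

text \<open>The expression is the height above the tangent at \<open>parab t\<close>. An enclosed
  point would be a positive combination of the corners, so these could not all lie strictly above a
  line through it.\<close>

lemma parab_not_enclosed:
  assumes "\<And>x. x \<in> {a, b, c} \<Longrightarrow> x = parab t \<or> x $ 2 - 2 * t * x $ 1 + t\<^sup>2 > 0"
  shows "\<not> enclosed (parab t) a b c"
proof
  assume e: "enclosed (parab t) a b c"
  define f where "f x = x $ 2 - 2 * t * x $ 1 + t\<^sup>2" for x :: "real^2"
  have "turn (parab t) b c * f a + turn (parab t) c a * f b + turn (parab t) a b * f c = 0"
    by (simp add: turn_def f_def coords power2_eq_square algebra_simps)
  moreover have "a \<noteq> parab t" "b \<noteq> parab t" "c \<noteq> parab t"
    using e by (auto simp: enclosed_def)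
  then have "f a > 0" "f b > 0" "f c > 0" unfolding f_def using assms[of a] assms[of b] assms[of c] by blast+
  then have "turn (parab t) b c * f a > 0" "turn (parab t) c a * f b > 0" "turn (parab t) a b * f c > 0"
    using e by (simp_all add: enclosed_def)
  ultimately show False by linarith
qed

text \<open>The last two hypotheses keep the axis points off the chords, which gives simplicity.
  Positive \<open>c\<close> and \<open>d\<close> put them above every tangent, so all points on the
  parabola are extreme.\<close>

lemma marked_parab:
  assumes "finite T" "0 \<notin> T" "c \<noteq> d" "c > 0" "d > 0"
    and "\<And>s t. s \<in> T \<Longrightarrow> t \<in> T \<Longrightarrow> s * t + c \<noteq> 0"
    and "\<And>s t. s \<in> T \<Longrightarrow> t \<in> T \<Longrightarrow> s * t + d \<noteq> 0"
  shows "marked_config (insert (axis_pt c) (insert (axis_pt d) (parab ` T))) (axis_pt c) (axis_pt d)"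
    (is "marked_config ?P ?p ?q")
proof
  show fin: "finite ?P" using assms by simp
  have "turn x y z \<noteq> 0" if "x \<in> ?P" "y \<in> ?P" "z \<in> ?P" "x \<noteq> y" "y \<noteq> z" "x \<noteq> z" for x y z
  proof -
    have nz: "t \<noteq> 0" if "t \<in> T" for t using that assms(2) by blast
    have rep: "w = ?p \<or> w = ?q \<or> (\<exists>t\<in>T. w = parab t)" if "w \<in> ?P" for w using that by blast
    have N3: "turn (parab r) (parab s) (parab t) \<noteq> 0" if "r \<noteq> s" "s \<noteq> t" "r \<noteq> t" for r s t
      using that by (simp add: turn_parab)
    have N2: "turn (axis_pt e) (parab s) (parab t) \<noteq> 0" "turn (parab s) (axis_pt e) (parab t) \<noteq> 0"
      "turn (parab s) (parab t) (axis_pt e) \<noteq> 0"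
      if "s \<in> T" "t \<in> T" "s \<noteq> t" "e = c \<or> e = d" for e s t
    proof -
      have "s * t + e \<noteq> 0" using that assms(6,7)[of s t] by blast
      then show "turn (axis_pt e) (parab s) (parab t) \<noteq> 0" "turn (parab s) (axis_pt e) (parab t) \<noteq> 0"
        "turn (parab s) (parab t) (axis_pt e) \<noteq> 0" using that(3) unfolding turn_parab by simp_all
    qed
    have N1: "turn (axis_pt e) (axis_pt f) (parab t) \<noteq> 0" "turn (axis_pt e) (parab t) (axis_pt f) \<noteq> 0"
      "turn (parab t) (axis_pt e) (axis_pt f) \<noteq> 0" if "t \<in> T" "e \<noteq> f" for e f t
      using that nz[of t] by (simp_all add: turn_parab)
    show ?thesis
      using rep[OF that(1)] rep[OF that(2)] rep[OF that(3)] that(4-6) assms(3)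
      by (elim disjE bexE) (simp_all add: N1 N2 N3)
  qed
  then have nc: "orientation x y z \<noteq> 0" if "x \<in> ?P" "y \<in> ?P" "z \<in> ?P" "x \<noteq> y" "y \<noteq> z" "x \<noteq> z" for x y z
    using that by (simp add: orientation_turn sgn_0_0)
  then show simp: "simple_config ?P"
    unfolding simple_config_def orientation_eq_0_iff_collinear by blast
  show "?p \<in> ?P" "?q \<in> ?P" by simp_all
  show "?p \<noteq> ?q" using assms by simp
  have "\<not> enclosed (parab t) x y z" if "t \<in> T" "x \<in> ?P" "y \<in> ?P" "z \<in> ?P" for t x y z
  proof (rule parab_not_enclosed)
    fix w assume "w \<in> {x, y, z}"
    then have "w \<in> ?P" using that by auto
    then consider "w = axis_pt c" | "w = axis_pt d" | s where "w = parab s" by auto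
    then show "w = parab t \<or> w $ 2 - 2 * t * w $ 1 + t\<^sup>2 > 0"
    proof cases
      case (3 s)
      have "w $ 2 - 2 * t * w $ 1 + t\<^sup>2 = (s - t)\<^sup>2" unfolding 3
        by (simp add: coords power2_eq_square algebra_simps)
      then show ?thesis using 3 by (cases "s = t") auto
    next
      case 1
      show ?thesis unfolding 1 coords using add_pos_nonneg[OF assms(4) zero_le_power2[of t]] by simp
    next
      case 2
      show ?thesis unfolding 2 coords using add_pos_nonneg[OF assms(5) zero_le_power2[of t]] by simp
    qed
  qed
  then show "interior_points ?P \<subseteq> {?p, ?q}"
    using interior_points_iff[OF fin simp] by blast
qed

text \<open>In these exponential parameters a chord between the two halves meets the axis at height
  \<open>exp (z - y)\<close>. Comparing it with \<open>exp r\<close> becomes the additive condition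
  \<open>z < y + r\<close>, so moving the axis point translates \<open>y\<close>.\<close>

lemma turn_axis_pt_iff:
  "turn (axis_pt (exp r)) (parab (- exp (- x))) (parab (- exp (- y))) > 0 \<longleftrightarrow> x < y"
  "turn (axis_pt (exp r)) (parab (exp z)) (parab (- exp (- y))) < 0 \<longleftrightarrow> z < y + r"
proof -
  have "exp (- x) * exp (- y) + exp r > 0" by (simp add: add_pos_pos)
  then show "turn (axis_pt (exp r)) (parab (- exp (- x))) (parab (- exp (- y))) > 0 \<longleftrightarrow> x < y"
    by (simp add: turn_parab zero_less_mult_iff)
  have "- exp (- y) - exp z < 0" using exp_gt_zero[of "- y"] exp_gt_zero[of z] by linarith
  then have "turn (axis_pt (exp r)) (parab (exp z)) (parab (- exp (- y))) < 0 \<longleftrightarrow>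
      0 < exp r - exp z * exp (- y)"
    by (simp add: turn_parab mult_less_0_iff)
  also have "\<dots> \<longleftrightarrow> exp (z - y) < exp r" by (simp add: exp_diff exp_minus divide_inverse)
  also have "\<dots> \<longleftrightarrow> z < y + r" by auto
  finally show "turn (axis_pt (exp r)) (parab (exp z)) (parab (- exp (- y))) < 0 \<longleftrightarrow> z < y + r" .
qed

text \<open>The left point \<open>u i\<close> is preceded by \<open>i\<close> left points and, about
  \<open>p\<close> and \<open>q\<close>, by the right points with \<open>z j < y i\<close> and
  \<open>z j < y i + 1\<close> respectively. The unit intervals are chosen so that there are
  \<open>a i\<close> and \<open>b i\<close> of these, which yields the required positions.\<close>

lemma code_realised:
  assumes "(A, B) \<in> codes n 0"
  shows "\<exists>P p q. marked_config P p q \<and> card P = n + 2 \<and> code P p q = (A, B)"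
proof -
  obtain k a b where kn: "k \<le> n" and mono: "monotone_below k a" "monotone_below k b"
    and ab: "\<And>i. i < k \<Longrightarrow> a i \<le> b i" and bn: "\<And>i. i < k \<Longrightarrow> b i \<le> n - k"
    and A: "A = (\<lambda>i. i + a i) ` {..<k}" and B: "B = (\<lambda>i. i + b i) ` {..<k}"
    by (rule codes_enumeration[OF assms]) (rule that)
  define m where "m = n - k"
  obtain y :: "nat \<Rightarrow> real" where y: "\<And>i j. i < k \<Longrightarrow> j < k \<Longrightarrow> i < j \<Longrightarrow> y i < y j"
    "\<And>i j. i < k \<Longrightarrow> j < k \<Longrightarrow> b i < a j \<Longrightarrow> y i + 1 < y j"
    "\<And>i j. i < k \<Longrightarrow> j < k \<Longrightarrow> a i < b j \<Longrightarrow> y i < y j + 1"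
    using unit_interval_left_ends[OF mono ab] by blast
  have "\<exists>z. (\<forall>j<m. \<forall>i<k. (if j < a i then z j < y i else y i < z j) \<and>
      (if j < b i then z j < y i + 1 else y i + 1 < z j)) \<and> (\<forall>j<m. \<forall>j'<j. z j' < z j)"
    by (rule interleaved_points) (fact y mono)+
  then obtain z :: "nat \<Rightarrow> real"
    where z1: "\<forall>j<m. \<forall>i<k. (if j < a i then z j < y i else y i < z j) \<and>
        (if j < b i then z j < y i + 1 else y i + 1 < z j)"
      and z2: "\<forall>j<m. \<forall>j'<j. z j' < z j"
    by blast
  define u where "u i = parab (- exp (- y i))" for i
  define l where "l j = parab (exp (z j))" for j
  define U L where "U = u ` {..<k}" and "L = l ` {..<m}"
  define T where "T = (\<lambda>i. - exp (- y i)) ` {..<k} \<union> (\<lambda>j. exp (z j)) ` {..<m}"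
  \<comment> \<open>The heights are \<open>exp 0\<close> and \<open>exp 1\<close>, giving the
    translations 0 and 1; \<open>p\<close> below \<open>q\<close> makes the left half of the
    parabola the left side of \<open>pq\<close>.\<close>
  define p q where "p = axis_pt 1" and "q = axis_pt (exp 1)"
  have pT: "parab ` T = U \<union> L" by (auto simp: T_def U_def L_def u_def l_def image_image)
  define P where "P = insert p (insert q (U \<union> L))"
  have yi: "y i < y j \<longleftrightarrow> i < j" if "i < k" "j < k" for i j
    using y(1)[of i j] y(1)[of j i] that by (cases i j rule: linorder_cases) auto
  have zi: "z i < z j \<longleftrightarrow> i < j" if "i < m" "j < m" for i j
    using z2[rule_format, of j i] z2[rule_format, of i j] that
    by (cases i j rule: linorder_cases) auto
  have yz: "z j < y i \<longleftrightarrow> j < a i" "y i < z j \<longleftrightarrow> \<not> j < a i" "z j \<noteq> y i"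
    "z j < y i + 1 \<longleftrightarrow> j < b i" "y i + 1 < z j \<longleftrightarrow> \<not> j < b i" "z j \<noteq> y i + 1" if "i < k" "j < m" for i j
    using z1[rule_format, OF that(2,1)] by (auto split: if_splits)
  have inj_u: "inj_on u {..<k}"
  proof (rule inj_onI)
    fix i j assume "i \<in> {..<k}" "j \<in> {..<k}" "u i = u j"
    then have "\<not> i < j" "\<not> j < i" using yi[of i j] yi[of j i] by (simp_all add: u_def)
    then show "i = j" by simp
  qed
  have inj_l: "inj_on l {..<m}"
  proof (rule inj_onI)
    fix i j assume "i \<in> {..<m}" "j \<in> {..<m}" "l i = l j"
    then have "\<not> i < j" "\<not> j < i" using zi[of i j] zi[of j i] by (simp_all add: l_def)
    then show "i = j" by simp
  qed
  have u_neq_l: "u i \<noteq> l j" for i j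
  proof -
    have "- exp (- y i) < exp (z j)" by (rule less_trans[of _ 0]) auto
    then show ?thesis by (auto simp: u_def l_def)
  qed
  have notpq: "u i \<noteq> p" "u i \<noteq> q" "l j \<noteq> p" "l j \<noteq> q" for i j
    by (auto simp: u_def l_def p_def q_def intro!: parab_neq_axis)
  have marked: "marked_config P p q"
    unfolding P_def p_def q_def pT[symmetric]
  proof (rule marked_parab)
    show "(1::real) \<noteq> exp 1" by simp
    have c: "s * t + exp c \<noteq> 0" if "s \<in> T" "t \<in> T" "c = 0 \<or> c = 1" for s t c
    proof -
      have mix: "exp (z j) * - exp (- y i) + exp c \<noteq> 0" if "i < k" "j < m" for i j
      proof
        assume "exp (z j) * - exp (- y i) + exp c = 0"
        then have "exp (z j - y i) = exp c" by (simp add: exp_diff exp_minus field_simps)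
        then have "z j = y i + c" by simp
        then show False using yz[OF that] \<open>c = 0 \<or> c = 1\<close> by auto
      qed
      have "exp x * exp x' + exp c \<noteq> 0" for x x' :: real
        by (metis add_pos_pos exp_gt_zero mult_pos_pos order_less_irrefl)
      then show ?thesis using that(1,2) mix by (auto simp: T_def mult.commute)
    qed
    show "s * t + 1 \<noteq> 0" if "s \<in> T" "t \<in> T" for s t using c[OF that, of 0] by simp
    show "s * t + exp 1 \<noteq> 0" if "s \<in> T" "t \<in> T" for s t using c[OF that, of 1] by simp
  qed (auto simp: T_def)
  have V: "P - {p, q} = U \<union> L" using notpq by (auto simp: P_def U_def L_def)
  have UL: "U \<inter> L = {}" using u_neq_l by (auto simp: U_def L_def)
  have card_UL: "card U = k" "card L = m" using inj_u inj_l by (simp_all add: U_def L_def card_image)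
  have fin: "finite U" "finite L" by (simp_all add: U_def L_def)
  have "p \<noteq> q" by (simp add: p_def q_def)
  moreover have "p \<notin> U \<union> L" "q \<notin> U \<union> L" using V by blast+
  ultimately have "card P = n + 2"
    using fin UL card_UL kn by (simp add: P_def card_Un_disjoint m_def)
  moreover have "code P p q = (A, B)"
  proof -
    have s: "turn p q (u i) > 0" "turn p q (l j) < 0" for i j
      by (simp_all add: p_def q_def u_def l_def turn_parab mult_less_0_iff zero_less_mult_iff)
    then have "\<not> turn p q (l j) > 0" for j by (simp add: less_imp_le not_less)
    with s have l: "left_of P p q = U"
      unfolding left_of_def V orientation_turn by (auto simp: U_def L_def)
    have exp_axis: "p = axis_pt (exp 0)" "q = axis_pt (exp 1)" by (simp_all add: p_def q_def)
    have uu: "before p q (u i) (u j) \<longleftrightarrow> y i < y j" "before q p (u i) (u j) \<longleftrightarrow> y i < y j" for i j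
    proof -
      have "turn p q (u i) * turn p q (u j) > 0" "turn q p (u i) * turn q p (u j) > 0"
        using s by (simp_all add: turn_swap'[of q p])
      then show "before p q (u i) (u j) \<longleftrightarrow> y i < y j" "before q p (u i) (u j) \<longleftrightarrow> y i < y j"
        unfolding before_same_side[OF \<open>turn p q (u i) * turn p q (u j) > 0\<close>]
          before_same_side[OF \<open>turn q p (u i) * turn q p (u j) > 0\<close>]
        unfolding exp_axis u_def by (simp_all only: turn_axis_pt_iff)
    qed
    have lu: "before p q (l j) (u i) \<longleftrightarrow> z j < y i" "before q p (l j) (u i) \<longleftrightarrow> z j < y i + 1" for i j
    proof -
      have n: "turn p q (l j) * turn p q (u i) < 0" "turn q p (l j) * turn q p (u i) < 0"
        using s by (simp_all add: turn_swap'[of q p] mult_neg_pos)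
      show "before p q (l j) (u i) \<longleftrightarrow> z j < y i" "before q p (l j) (u i) \<longleftrightarrow> z j < y i + 1"
        unfolding before_other_side[OF n(1)] before_other_side[OF n(2)]
        unfolding exp_axis u_def l_def by (simp_all only: turn_axis_pt_iff add_0_right)
    qed
    have rank: "rank r (U \<union> L) (u i) = i + f i"
      if i: "i < k" and r: "\<And>j. j < k \<Longrightarrow> r (u j) (u i) \<longleftrightarrow> j < i"
        "\<And>j. j < m \<Longrightarrow> r (l j) (u i) \<longleftrightarrow> j < f i" and f: "f i \<le> m" for r i and f :: "nat \<Rightarrow> nat"
    proof -
      have "{w \<in> U \<union> L. r w (u i)} = u ` {..<i} \<union> l ` {..<f i}"
        using i r f by (auto simp: U_def L_def)
      moreover have "card (u ` {..<i}) = i" "card (l ` {..<f i}) = f i"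
        using inj_on_subset[OF inj_u, of "{..<i}"] inj_on_subset[OF inj_l, of "{..<f i}"] i f
        by (simp_all add: card_image)
      moreover have "u ` {..<i} \<inter> l ` {..<f i} = {}" using u_neq_l by auto
      ultimately show ?thesis by (simp add: rank_def card_Un_disjoint)
    qed
    have "rank (before p q) (U \<union> L) (u i) = i + a i" "rank (before q p) (U \<union> L) (u i) = i + b i"
      if i: "i < k" for i
    proof -
      have "b i \<le> m" "a i \<le> m" using bn[OF i] ab[OF i] by (simp_all add: m_def)
      then show "rank (before p q) (U \<union> L) (u i) = i + a i" "rank (before q p) (U \<union> L) (u i) = i + b i"
        using i yi yz by (auto intro!: rank simp: uu lu)
    qed
    moreover have "P - {q, p} = U \<union> L" using V by auto
    ultimately show ?thesis
      unfolding code_def l V by (auto simp: A B U_def image_image intro!: image_cong)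
  qed
  ultimately show ?thesis using marked by blast
qed

section \<open>Order types and codes\<close>

context marked_config
begin

lemma card_V: "card V = card P - 2"
  using finite_P p_in q_in p_neq_q by (simp add: card_Diff_subset)

lemma rank_q_less:
  "x \<in> V \<Longrightarrow> y \<in> V \<Longrightarrow> rank (before q p) V x < rank (before q p) V y \<longleftrightarrow> before q p x y"
  and rank_q_bij: "bij_betw (rank (before q p) V) V {..<card V}"
proof -
  interpret sw: marked_config P q p by (rule swap)
  have comm: "{q, p} = {p, q}" by auto
  show "x \<in> V \<Longrightarrow> y \<in> V \<Longrightarrow> rank (before q p) V x < rank (before q p) V y \<longleftrightarrow> before q p x y"
    using sw.rank_p_less[unfolded comm, of x y] finite_P by simp
  show "bij_betw (rank (before q p) V) V {..<card V}"
    using sw.rank_p_bij[unfolded comm] finite_P by simp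
qed

text \<open>From \<open>p\<close> to \<open>q\<close> a left point keeps all its predecessors: left
  ones by \<open>before_swap\<close>, right ones by \<open>before_cross\<close>. Its position
  therefore never decreases, and the prefix counts compare.\<close>

lemma code_in_codes: "code P p q \<in> codes (card P - 2) 0"
proof -
  let ?L = "left_of P p q"
  define rp rq where "rp = rank (before p q) V" and "rq = rank (before q p) V"
  have fin: "finite V" using finite_P by simp
  have L: "?L \<subseteq> V" by (auto simp: left_of_def)
  have finL: "finite ?L" using L fin finite_subset by blast
  have bij: "bij_betw rp V {..<card V}" "bij_betw rq V {..<card V}"
    unfolding rp_def rq_def by (rule rank_p_bij[OF fin], rule rank_q_bij)
  have inj: "inj_on rp ?L" "inj_on rq ?L" using bij L by (auto simp: bij_betw_def intro: inj_on_subset)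
  have sub: "rp ` ?L \<subseteq> {..<card V}" "rq ` ?L \<subseteq> {..<card V}"
    using bij L by (auto simp: bij_betw_def)
  have le: "rp u \<le> rq u" if u: "u \<in> ?L" for u
    unfolding rp_def rq_def rank_def
  proof (rule card_mono)
    show "finite {w \<in> V. before q p w u}" using fin by simp
    have "before q p w u" if w: "w \<in> V" "before p q w u" for w
    proof (cases "w \<in> ?L")
      case True
      then show ?thesis using before_swap[of w u] w u L by blast
    next
      case False
      then have "turn p q w < 0" using w turn_pq[of w] by (auto simp: left_of_turn)
      then show ?thesis using before_cross[of u w] u w by (auto simp: left_of_turn)
    qed
    then show "{w \<in> V. before p q w u} \<subseteq> {w \<in> V. before q p w u}" by blast
  qed
  have card_below: "card (r ` ?L \<inter> {..<t}) = card {u \<in> ?L. r u < t}" if "inj_on r ?L" for r :: "_ \<Rightarrow> nat" and t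
  proof -
    have "r ` ?L \<inter> {..<t} = r ` {u \<in> ?L. r u < t}" by auto
    moreover have "inj_on r {u \<in> ?L. r u < t}" using that by (rule inj_on_subset) auto
    ultimately show ?thesis by (simp add: card_image)
  qed
  have "card (rq ` ?L \<inter> {..<t}) \<le> card (rp ` ?L \<inter> {..<t})" for t
    unfolding card_below[OF inj(1)] card_below[OF inj(2)]
    using finL le by (intro card_mono) (auto intro: le_less_trans)
  moreover have "card (rp ` ?L) = card (rq ` ?L)" using inj by (simp add: card_image)
  moreover have "{q, p} = {p, q}" by auto
  ultimately show ?thesis
    using sub unfolding card_V by (simp add: code_def codes_def rp_def rq_def)
qed

text \<open>Modulo \<pi> the line to \<open>l\<close> runs between the lines to \<open>u\<close> and
  \<open>v\<close>. Since \<open>l\<close> is on the other side of \<open>pq\<close>, its ray points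
  the opposite way, and the three rays surround \<open>p\<close>.\<close>

lemma enclosed_of_before:
  assumes "turn p q u * turn p q v > 0" "turn p q u * turn p q l < 0" "turn p q l * turn p q v < 0"
    and "before p q u l" "before p q l v" "before p q u v"
  shows "enclosed p u v l"
  using before_same_side[OF assms(1)] before_other_side[OF assms(2)] before_other_side[OF assms(3)] assms(4-6)
    turn_swap[of p u l] turn_swap[of p l v]
  by (simp add: enclosed_def)

text \<open>A pattern left-right-left in the order about a marked point supplies three points that
  surround it.\<close>

lemma alternation_interior:
  assumes "r < s" "s < t" "t < card V"
  shows "r \<in> fst (code P p q) \<Longrightarrow> s \<notin> fst (code P p q) \<Longrightarrow> t \<in> fst (code P p q) \<Longrightarrow> p \<in> interior_points P"
    and "r \<in> snd (code P p q) \<Longrightarrow> s \<notin> snd (code P p q) \<Longrightarrow> t \<in> snd (code P p q) \<Longrightarrow> q \<in> interior_points P"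
proof -
  have fin: "finite V" using finite_P by simp
  have comm: "{q, p} = {p, q}" by auto
  have main: "\<exists>u v l. u \<in> left_of P p q \<and> v \<in> left_of P p q \<and> l \<in> V - left_of P p q \<and>
      rk u = r \<and> rk l = s \<and> rk v = t"
    if A: "r \<in> rk ` left_of P p q" "s \<notin> rk ` left_of P p q" "t \<in> rk ` left_of P p q"
      and bij: "bij_betw rk V {..<card V}" for rk
  proof -
    have "s \<in> rk ` V" using bij assms by (auto simp: bij_betw_def)
    then obtain l where "l \<in> V" "rk l = s" by blast
    then show ?thesis using A by blast
  qed
  have signs: "turn p q u * turn p q v > 0" "turn p q u * turn p q l < 0" "turn p q l * turn p q v < 0"
    if uvl: "u \<in> left_of P p q" "v \<in> left_of P p q" "l \<in> V - left_of P p q" for u v l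
  proof -
    have "turn p q u > 0" "turn p q v > 0" "turn p q l < 0"
      using uvl turn_pq[of l] by (auto simp: left_of_turn)
    then show "turn p q u * turn p q v > 0" "turn p q u * turn p q l < 0" "turn p q l * turn p q v < 0"
      by (simp_all add: mult_less_0_iff)
  qed
  show "p \<in> interior_points P"
    if h: "r \<in> fst (code P p q)" "s \<notin> fst (code P p q)" "t \<in> fst (code P p q)"
  proof -
    obtain u v l where uvl: "u \<in> left_of P p q" "v \<in> left_of P p q" "l \<in> V - left_of P p q"
      and rk: "rank (before p q) V u = r" "rank (before p q) V l = s" "rank (before p q) V v = t"
      using main[OF h[unfolded code_def fst_conv] rank_p_bij[OF fin]] by blast
    have V: "u \<in> V" "v \<in> V" "l \<in> V" using uvl by (auto simp: left_of_def)
    have "before p q u l" "before p q l v" "before p q u v"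
      using rank_p_less[OF fin V(1,3)] rank_p_less[OF fin V(3,2)] rank_p_less[OF fin V(1,2)]
        rk assms(1,2) by simp_all
    then have "enclosed p u v l" using enclosed_of_before signs[OF uvl] by blast
    then show ?thesis using interior_points_iff[OF finite_P simple] V p_in by blast
  qed
  show "q \<in> interior_points P"
    if h: "r \<in> snd (code P p q)" "s \<notin> snd (code P p q)" "t \<in> snd (code P p q)"
  proof -
    interpret sw: marked_config P q p by (rule swap)
    obtain u v l where uvl: "u \<in> left_of P p q" "v \<in> left_of P p q" "l \<in> V - left_of P p q"
      and rk: "rank (before q p) V u = r" "rank (before q p) V l = s" "rank (before q p) V v = t"
      using main[OF h[unfolded code_def snd_conv] rank_q_bij] by blast
    have V: "u \<in> V" "v \<in> V" "l \<in> V" using uvl by (auto simp: left_of_def)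
    have "before q p u l" "before q p l v" "before q p u v"
      using rank_q_less[OF V(1,3)] rank_q_less[OF V(3,2)] rank_q_less[OF V(1,2)] rk assms(1,2)
      by simp_all
    moreover have "turn q p u * turn q p v > 0" "turn q p u * turn q p l < 0" "turn q p l * turn q p v < 0"
      using signs[OF uvl] by (simp_all add: turn_swap'[of q p])
    ultimately have "enclosed q u v l" using sw.enclosed_of_before by blast
    then show ?thesis using interior_points_iff[OF finite_P simple] V q_in by blast
  qed
qed

end

section \<open>Invariance of simplicity and of interior points\<close>

lemma orientation_iso_simple:
  assumes "orientation_iso f P Q" "simple_config P"
  shows "simple_config Q"
  unfolding simple_config_def orientation_eq_0_iff_collinear[symmetric]
proof (intro ballI impI)
  have Q: "Q = f ` P" using assms(1) by (auto simp: orientation_iso_def bij_betw_def)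
  fix a b c assume "a \<in> Q" "b \<in> Q" "c \<in> Q" and ne: "a \<noteq> b \<and> b \<noteq> c \<and> a \<noteq> c"
  then obtain a' b' c' where abc: "a' \<in> P" "b' \<in> P" "c' \<in> P" "a = f a'" "b = f b'" "c = f c'"
    unfolding Q by blast
  then have "orientation a b c = orientation a' b' c'" using assms(1) by (simp add: orientation_iso_def)
  moreover have "a' \<noteq> b' \<and> b' \<noteq> c' \<and> a' \<noteq> c'" using abc ne by blast
  then have "orientation a' b' c' \<noteq> 0"
    unfolding orientation_eq_0_iff_collinear using abc assms(2) by (simp add: simple_config_def)
  ultimately show "orientation a b c \<noteq> 0" by simp
qed

text \<open>By \<open>interior_points_iff\<close>, being interior depends on orientations
  alone.\<close>

lemma orientation_iso_interior:
  assumes "orientation_iso f P Q" "simple_config P" "finite P"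
  shows "interior_points Q = f ` interior_points P"
proof -
  have Q: "Q = f ` P" using assms(1) by (auto simp: orientation_iso_def bij_betw_def)
  have e: "enclosed (f x) (f a) (f b) (f c) \<longleftrightarrow> enclosed x a b c"
    if "x \<in> P" "a \<in> P" "b \<in> P" "c \<in> P" for x a b c
  proof -
    have o: "enclosed x a b c \<longleftrightarrow> orientation x a b > 0 \<and> orientation x b c > 0 \<and> orientation x c a > 0" for x a b c
      by (simp add: enclosed_def orientation_turn)
    show ?thesis using that assms(1) unfolding o by (simp add: orientation_iso_def)
  qed
  have "simple_config Q" by (rule orientation_iso_simple[OF assms(1,2)])
  moreover have "finite Q" using assms(3) Q by simp
  ultimately have "interior_points Q = {y \<in> f ` P. \<exists>a\<in>f ` P. \<exists>b\<in>f ` P. \<exists>c\<in>f ` P. enclosed y a b c}"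
    using interior_points_iff[of Q] unfolding Q by blast
  also have "\<dots> = f ` {x \<in> P. \<exists>a\<in>P. \<exists>b\<in>P. \<exists>c\<in>P. enclosed x a b c}"
  proof -
    have "(\<exists>a\<in>f ` P. \<exists>b\<in>f ` P. \<exists>c\<in>f ` P. enclosed (f x) a b c) \<longleftrightarrow>
        (\<exists>a\<in>P. \<exists>b\<in>P. \<exists>c\<in>P. enclosed x a b c)" if "x \<in> P" for x
      using e[OF that] by (simp cong: bex_cong)
    then show ?thesis by blast
  qed
  also have "{x \<in> P. \<exists>a\<in>P. \<exists>b\<in>P. \<exists>c\<in>P. enclosed x a b c} = interior_points P"
    using interior_points_iff[OF assms(3,2)] by blast
  finally show ?thesis .
qed

section \<open>Members of an order type and their codes\<close>

lemma order_types_iso: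
  assumes "T \<in> order_types" "P \<in> T" "Q \<in> T"
  obtains f where "orientation_iso f P Q"
proof -
  have "(P, Q) \<in> order_type_rel"
    using quotient_eq_iff[OF equiv_order_type_rel, of T T P Q] assms by (simp add: order_types_def)
  then show ?thesis using that by (auto simp: order_type_rel_def same_order_type_iso)
qed

lemma order_types_finite: "T \<in> order_types \<Longrightarrow> P \<in> T \<Longrightarrow> finite P"
  using in_quotient_imp_subset[OF equiv_order_type_rel] by (auto simp: order_types_def)

lemma order_types_eqI:
  assumes "T \<in> order_types" "T' \<in> order_types" "P \<in> T" "P' \<in> T'" "same_order_type P P'"
  shows "T = T'"
proof -
  have "(P, P') \<in> order_type_rel" using assms order_types_finite by (auto simp: order_type_rel_def)
  then show ?thesis
    using quotient_eq_iff[OF equiv_order_type_rel, of T T' P P'] assms by (simp add: order_types_def)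
qed

text \<open>A relation rather than a function, since different marked pairs of the same
  configuration may give different codes.\<close>

definition has_code :: "nat \<Rightarrow> (real^2) set set \<Rightarrow> nat set \<times> nat set \<Rightarrow> bool" where
  "has_code n T c \<longleftrightarrow> (\<exists>P\<in>T. \<exists>p q. marked_config P p q \<and> card P = n + 2 \<and> code P p q = c)"

lemma has_code_in_codes: "has_code n T c \<Longrightarrow> c \<in> codes n 0"
  using marked_config.code_in_codes by (fastforce simp: has_code_def)

lemma has_code_inj:
  assumes "T \<in> order_types" "T' \<in> order_types" "has_code n T c" "has_code n T' c"
  shows "T = T'"
proof -
  obtain P p q where P: "P \<in> T" "marked_config P p q" "card P = n + 2" "code P p q = c"
    using assms(3) unfolding has_code_def by blast
  obtain P' p' q' where P': "P' \<in> T'" "marked_config P' p' q'" "card P' = n + 2" "code P' p' q' = c"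
    using assms(4) unfolding has_code_def by blast
  have "same_order_type P P'" by (rule order_type_of_code[OF P(2) P'(2)]) (simp_all add: P P')
  then show ?thesis using order_types_eqI[OF assms(1,2) P(1) P'(1)] by blast
qed

lemma has_code_exists:
  assumes "T \<in> simple_order_types (n + 2) 2"
  shows "\<exists>c. has_code n T c"
proof -
  have T: "T \<in> order_types" using assms by (simp add: simple_order_types_def)
  then have "T \<noteq> {}" using in_quotient_imp_non_empty[OF equiv_order_type_rel] by (auto simp: order_types_def)
  then obtain P where P: "P \<in> T" by blast
  then have s: "simple_config P" "card P = n + 2" "card (interior_points P) \<le> 2"
    using assms by (auto simp: simple_order_types_def)
  have fin: "finite P" using order_types_finite T P by blast
  have "interior_points P \<subseteq> P" by (auto simp: interior_points_def)
  \<comment> \<open>With fewer than two interior points, extreme points complete the marked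
    pair.\<close>
  then obtain J where J: "interior_points P \<subseteq> J" "J \<subseteq> P" "card J = 2"
    using exists_subset_between[of "interior_points P" 2 P] s fin by auto
  then obtain p q where "J = {p, q}" "p \<noteq> q" by (auto simp: card_2_iff)
  then have "marked_config P p q" using J fin s by unfold_locales auto
  then show ?thesis using P s unfolding has_code_def by blast
qed

lemma marked_order_type:
  assumes "marked_config P p q" "card P = n + 2"
  shows "\<exists>T \<in> simple_order_types (n + 2) 2. has_code n T (code P p q)"
proof -
  interpret marked_config P p q by fact
  define T where "T = order_type_rel `` {P}"
  have T: "T \<in> order_types" unfolding T_def order_types_def using finite_P by (auto intro: quotientI)
  have PT: "P \<in> T" unfolding T_def using equiv_class_self[OF equiv_order_type_rel] finite_P by auto
  have "simple_config Q \<and> card Q = n + 2 \<and> card (interior_points Q) \<le> 2" if Q: "Q \<in> T" for Q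
  proof -
    obtain f where f: "orientation_iso f P Q" by (rule order_types_iso[OF T PT Q])
    have "card (f ` interior_points P) \<le> card (interior_points P)"
      using interior finite_subset by (intro card_image_le) blast
    also have "\<dots> \<le> card {p, q}" using interior by (intro card_mono) auto
    also have "\<dots> \<le> 2" by (simp add: card_insert_le_m1)
    finally have "card (interior_points Q) \<le> 2"
      unfolding orientation_iso_interior[OF f simple finite_P] .
    moreover have "card Q = card P" using f bij_betw_same_card by (force simp: orientation_iso_def)
    ultimately show ?thesis using orientation_iso_simple[OF f simple] assms(2) by simp
  qed
  then have "T \<in> simple_order_types (n + 2) 2" using T by (simp add: simple_order_types_def)
  then show ?thesis using PT assms by (auto simp: has_code_def)
qed

text \<open>Any choice of one code per order type is injective, because a code determines the order
  type.\<close>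

lemma card_simple_order_types_le:
  "finite (simple_order_types (n + 2) 2)" "card (simple_order_types (n + 2) 2) \<le> card (codes n 0)"
proof -
  let ?S = "simple_order_types (n + 2) 2"
  define F where "F T = (SOME c. has_code n T c)" for T
  have F: "has_code n T (F T)" if "T \<in> ?S" for T
    unfolding F_def by (rule someI_ex[OF has_code_exists[OF that]])
  have "inj_on F ?S"
  proof (rule inj_onI)
    fix T T' assume T: "T \<in> ?S" "T' \<in> ?S" "F T = F T'"
    then show "T = T'" using has_code_inj[of T T' n "F T"] F[of T] F[of T'] by (auto simp: simple_order_types_def)
  qed
  moreover have "F ` ?S \<subseteq> codes n 0" using F has_code_in_codes by blast
  ultimately show "finite ?S" "card ?S \<le> card (codes n 0)"
    using inj_on_finite[of F ?S] card_inj_on_le[of F ?S] finite_codes by simp_all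
qed

text \<open>Appends the steps up, flat, up to both paths, the position \<open>n + 1\<close> staying
  out of both sets. This is the pattern left-right-left that makes both marked points
  interior.\<close>

definition alternating_extension :: "nat \<Rightarrow> nat set \<times> nat set \<Rightarrow> nat set \<times> nat set" where
  "alternating_extension n = (\<lambda>(A, B). (insert (n + 2) (insert n A), insert (n + 2) (insert n B)))"

lemma codes_extend_both:
  assumes "(A, B) \<in> codes n h"
  shows "(extend n a A, extend n a B) \<in> codes (Suc n) h"
  using assms codes_extend[of A n B a a h] by (simp add: codes_def)

lemma alternating_extension_in_codes:
  assumes "c \<in> codes n 0"
  shows "alternating_extension n c \<in> codes (n + 3) 0"
proof -
  obtain A B where c: "c = (A, B)" by (cases c)
  have "(extend (Suc (Suc n)) True (extend (Suc n) False (extend n True A)),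
      extend (Suc (Suc n)) True (extend (Suc n) False (extend n True B))) \<in> codes (Suc (Suc (Suc n))) 0"
    using assms by (intro codes_extend_both) (simp add: c)
  then show ?thesis by (simp add: c alternating_extension_def extend_def eval_nat_numeral)
qed

lemma alternating_extension_inj: "inj_on (alternating_extension n) (codes n 0)"
proof (rule inj_onI)
  fix c d assume cd: "c \<in> codes n 0" "d \<in> codes n 0" "alternating_extension n c = alternating_extension n d"
  have "insert (n + 2) (insert n A) \<inter> {..<n} = A" if "A \<subseteq> {..<n}" for A using that by auto
  then have "map_prod (\<lambda>A. A \<inter> {..<n}) (\<lambda>A. A \<inter> {..<n}) (alternating_extension n e) = e" if "e \<in> codes n 0" for e
    using that by (auto simp: alternating_extension_def codes_def split: prod.splits)
  then show "c = d" using cd by metis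
qed

text \<open>For an extended code the marked points are exactly the two interior points. Isomorphisms
  preserve these as a set, so the only freedom left is their order.\<close>

lemma few_alternating_codes:
  assumes T: "T \<in> order_types"
  shows "card {c \<in> alternating_extension n ` codes n 0. has_code (n + 3) T c} \<le> 2" (is "card ?C \<le> 2")
proof (cases "?C = {}")
  case False
  have interior_eq: "interior_points P = {p, q}"
    if m: "marked_config P p q" "card P = n + 3 + 2" and c: "code P p q \<in> alternating_extension n ` codes n 0" for P p q
  proof -
    interpret marked_config P p q by fact
    obtain A B where AB: "(A, B) \<in> codes n 0" "code P p q = alternating_extension n (A, B)" using c by auto
    then have "A \<subseteq> {..<n}" "B \<subseteq> {..<n}" by (auto simp: codes_def)
    then have "n \<in> fst (code P p q)" "n + 1 \<notin> fst (code P p q)" "n + 2 \<in> fst (code P p q)"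
      "n \<in> snd (code P p q)" "n + 1 \<notin> snd (code P p q)" "n + 2 \<in> snd (code P p q)"
      unfolding AB(2) by (auto simp: alternating_extension_def)
    then have "p \<in> interior_points P" "q \<in> interior_points P"
      using alternation_interior(1)[of n "n + 1" "n + 2"] alternation_interior(2)[of n "n + 1" "n + 2"]
      unfolding card_V m(2) by force+
    then show ?thesis using interior by blast
  qed
  from False obtain P p q where P: "P \<in> T" "marked_config P p q" "card P = n + 3 + 2"
    "code P p q \<in> alternating_extension n ` codes n 0" by (auto simp: has_code_def)
  have "?C \<subseteq> {code P p q, code P q p}"
  proof
    fix c assume "c \<in> ?C"
    then obtain Q r s where Q: "Q \<in> T" "marked_config Q r s" "card Q = n + 3 + 2" "code Q r s = c"
      and c: "c \<in> alternating_extension n ` codes n 0" by (auto simp: has_code_def)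
    interpret Q: marked_config Q r s by fact
    obtain f where f: "orientation_iso f Q P" by (rule order_types_iso[OF T Q(1) P(1)])
    have "interior_points Q = {r, s}" by (rule interior_eq[OF Q(2,3) c[folded Q(4)]])
    then have "{p, q} = {f r, f s}"
      using orientation_iso_interior[OF f Q.simple Q.finite_P] unfolding interior_eq[OF P(2-4)] by simp
    then have "f r = p \<and> f s = q \<or> f r = q \<and> f s = p" by (auto simp: doubleton_eq_iff)
    then have "code P (f r) (f s) \<in> {code P p q, code P q p}" by blast
    then show "c \<in> {code P p q, code P q p}" unfolding code_iso[OF f Q.p_in Q.q_in] Q(4) .
  qed
  then have "card ?C \<le> card {code P p q, code P q p}" by (intro card_mono) auto
  also have "\<dots> \<le> 2" by (simp add: card_insert_le_m1)
  finally show ?thesis .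
next
  case True
  then show ?thesis by (simp only: card.empty)
qed

text \<open>Every extended code is realised by some order type, and each order type accounts for at
  most two of them.\<close>

lemma card_simple_order_types_ge: "card (codes n 0) \<le> 2 * card (simple_order_types (n + 3 + 2) 2)"
proof -
  let ?S = "simple_order_types (n + 3 + 2) 2"
  define C where "C = alternating_extension n ` codes n 0"
  have "card (codes n 0) = card C"
    unfolding C_def using card_image[OF alternating_extension_inj] by simp
  also have "\<dots> \<le> card (\<Union>T\<in>?S. {c \<in> C. has_code (n + 3) T c})"
  proof (rule card_mono)
    show "finite (\<Union>T\<in>?S. {c \<in> C. has_code (n + 3) T c})"
      by (rule finite_subset[of _ C]) (auto simp: C_def finite_codes)
    have "\<exists>T\<in>?S. has_code (n + 3) T c" if "c \<in> C" for c
    proof -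
      have "c \<in> codes (n + 3) 0" using that alternating_extension_in_codes by (auto simp: C_def)
      moreover obtain A B where "c = (A, B)" by (cases c)
      ultimately obtain P p q where "marked_config P p q" "card P = n + 3 + 2" "code P p q = c"
        using code_realised[of A B "n + 3"] by blast
      then show ?thesis using marked_order_type[of P p q "n + 3"] by blast
    qed
    then show "C \<subseteq> (\<Union>T\<in>?S. {c \<in> C. has_code (n + 3) T c})" by blast
  qed
  also have "\<dots> \<le> (\<Sum>T\<in>?S. card {c \<in> C. has_code (n + 3) T c})"
    by (rule card_UN_le) (rule card_simple_order_types_le(1))
  also have "\<dots> \<le> (\<Sum>T\<in>?S. 2)"
    unfolding C_def by (intro sum_mono few_alternating_codes) (simp add: simple_order_types_def)
  finally show ?thesis by simp
qed

theorem theorem3p7: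
  shows "(\<lambda>n::nat. real (card (simple_order_types (n + 2) 2)))
           \<in> \<Theta>(\<lambda>n. 4 ^ n / real n powr (3 / 2))"
proof (rule bigthetaI)
  define g where "g n = 4 ^ n / real n powr (3 / 2)" for n :: nat
  define F where "F n = real (card (simple_order_types (n + 2) 2))" for n
  have upper: "F n \<le> 4 * g n" if "n \<ge> 1" for n
    using card_codes_bounds(1)[OF that] card_simple_order_types_le(2)[of n]
    unfolding F_def g_def by linarith
  \<comment> \<open>\<open>512 = 4 ^ 3 * 4 * 2\<close>: the three appended steps, the constant of
    \<open>card_codes_bounds\<close>, and two codes per order type. From \<open>n = 4\<close> on,
    \<open>k\<close> is positive.\<close>
  have lower: "g n \<le> 512 * F n" if n: "n \<ge> 4" for n
  proof -
    obtain k where k: "n = k + 3" "k \<ge> 1" using that[of "n - 3"] n by simp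
    have pos: "real k powr (3 / 2) > 0" using k by simp
    have "g n \<le> 4 ^ n / real k powr (3 / 2)"
      unfolding g_def using k pos by (intro divide_left_mono powr_mono2 mult_pos_pos) auto
    also have "\<dots> = 64 * g k" by (simp add: g_def k power_add)
    also have "\<dots> \<le> 64 * (4 * real (card (codes k 0)))"
      using card_codes_bounds(2)[OF k(2)] unfolding g_def by simp
    also have "\<dots> \<le> 64 * (4 * (2 * F n))"
      using card_simple_order_types_ge[of k] unfolding F_def k(1) by linarith
    finally show ?thesis by simp
  qed
  have nonneg: "F n \<ge> 0" "g n \<ge> 0" for n by (simp_all add: F_def g_def)
  have "F \<in> O(g)"
    by (rule bigoI[of _ 4], rule eventually_sequentiallyI[of 1]) (use upper nonneg in simp)
  then show "(\<lambda>n. real (card (simple_order_types (n + 2) 2))) \<in> O(\<lambda>n. 4 ^ n / real n powr (3 / 2))"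
    unfolding F_def g_def .
  have "g \<in> O(F)"
    by (rule bigoI[of _ 512], rule eventually_sequentiallyI[of 4]) (use lower nonneg in simp)
  then have "F \<in> \<Omega>(g)" by (simp add: bigomega_iff_bigo)
  then show "(\<lambda>n. real (card (simple_order_types (n + 2) 2))) \<in> \<Omega>(\<lambda>n. 4 ^ n / real n powr (3 / 2))"
    unfolding F_def g_def .
qed

end
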